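(* Let $(Q,N,C_1,C_2,\dots)$ be a real-valued random vector with $N\in\mathbb{N}=\{0,1,2,\dots\}$, and for $\gamma>0$ let $\rho_\gamma = E\left[\sum_{i=1}^N |C_i|^\gamma\right]$. Suppose that for some $\beta>1$ we have $E[|Q|^\beta]<\infty$ and $E\left[\left(\sum_{i=1}^N |C_i|\right)^\beta\right]<\infty$, and in addition that either (i) $\max\{\rho_1,\rho_\beta\}<1$, or (ii) $\beta=2$, $\rho_1=1$, $\rho_\beta<1$ and $E[Q]=0$. Suppose $h:\mathbb{R}\to\mathbb{R}$ is continuous and $|h(x)|\le C(1+|x|)$ for all $x\in\mathbb{R}$ and some constant $C>0$. Let $k\ge0$ be a fixed integer, and for each $m\ge 1$ let $\mathcal P^{(k,m)}=(\hat R^{(k,m)}_1,\dots,\hat R^{(k,m)}_m)$ be the level-$k$ sample pool produced by the iterative bootstrap algorithm with pool size $m$ (defined in the context). Then $$\frac1m\sum_{i=1}^m h(\hat R^{(k,m)}_i)$$ is a consistent estimator for $E[h(R^{(k)})]$, i.e., it converges in probability to $E[h(R^{(k)})]$ as $m\to\infty$.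
   Context: **The process $R^{(k)}$.** The components of the generic branching vector $(Q,N,C_1,C_2,\dots)$ may be arbitrarily dependent on each other. Let $\mathbb{N}_+=\{1,2,\dots\}$ and $U=\bigcup_{k\ge 0}(\mathbb{N}_+)^k$, the set of finite sequences of positive integers, with $(\mathbb{N}_+)^0=\{\emptyset\}$; $(\mathbf i,j)$ denotes concatenation. Let $\{(Q_{\mathbf i},N_{\mathbf i},C_{(\mathbf i,1)},C_{(\mathbf i,2)},\dots)\}_{\mathbf i\in U}$ be i.i.d. copies of the generic branching vector. Set $A_0=\{\emptyset\}$ and $A_n=\{(\mathbf i,j)\in U:\mathbf i\in A_{n-1},\ 1\le j\le N_{\mathbf i}\}$ for $n\ge1$; set $\Pi_\emptyset=1$ and $\Pi_{(\mathbf i,j)}=C_{(\mathbf i,j)}\Pi_{\mathbf i}$. Define $$R^{(k)}=\sum_{j=0}^k\sum_{\mathbf i\in A_j}Q_{\mathbf i}\Pi_{\mathbf i},\qquad k\ge 0.$$ The laws satisfy $R^{(0)}\stackrel{\mathcal D}{=}Q$ and $R^{(k)}\stackrel{\mathcal D}{=}\sum_{r=1}^N C_rR^{(k-1)}_r+Q$ for $k\ge1$, where $\{R^{(k-1)}_r\}_{r\ge1}$ are i.i.d. copies of $R^{(k-1)}$ independent of $(Q,N,C_1,C_2,\dots)$. **The iterative bootstrap algorithm.** Fix $m\in\mathbb{N}_+$. The sample pools $\mathcal P^{(j,m)}=(\hat R^{(j,m)}_1,\dots,\hat R^{(j,m)}_m)$, $j\ge 0$, are generated as follows. - Level $0$: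 $\hat R^{(0,m)}_i=Q_i$, $i=1,\dots,m$, where $Q_1,\dots,Q_m$ are i.i.d. copies of $Q$. - Level $j\ge1$: take $m$ fresh i.i.d. copies $\{(Q_i,N_i,C_{(i,1)},C_{(i,2)},\dots)\}_{i=1}^m$ of the generic branching vector, independent of everything else, and set $$\hat R^{(j,m)}_i=\sum_{r=1}^{N_i}C_{(i,r)}\hat R^{(j-1,m)}_{(i,r)}+Q_i,\qquad i=1,\dots,m,$$ where the $\hat R^{(j-1,m)}_{(i,r)}$ are sampled uniformly with replacement from the pool $\mathcal P^{(j-1,m)}$ (i.e., $\hat R^{(j-1,m)}_{(i,r)}=\hat R^{(j-1,m)}_{J(i,r)}$ with indices $J(i,r)$ i.i.d. uniform on $\{1,\dots,m\}$, independent of everything else). The estimator equals $\int_{\mathbb{R}}h(x)\,d\hat F_{k,m}(x)$, where $\hat F_{k,m}(x)=\frac1m\sum_{i=1}^m 1(\hat R^{(k,m)}_i\le x)$. *)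

theory Defs
  imports "HOL-Probability.Probability"
begin

section \<open>The generic branching vector\<close>

definition branching_space :: "(real \<times> nat \<times> (nat \<Rightarrow> real)) measure" where
  "branching_space = borel \<Otimes>\<^sub>M count_space UNIV \<Otimes>\<^sub>M (\<Pi>\<^sub>M r\<in>{1..}. borel)"

text \<open>The vector \<open>(Q, N, C\<^sub>1, C\<^sub>2, \<dots>)\<close>. The weights are numbered from 1, and the value of
  \<open>C\<close> at 0 is discarded by the restriction.\<close>

definition branching_vector ::
  "('a \<Rightarrow> real) \<Rightarrow> ('a \<Rightarrow> nat) \<Rightarrow> (nat \<Rightarrow> 'a \<Rightarrow> real) \<Rightarrow> 'a \<Rightarrow> real \<times> nat \<times> (nat \<Rightarrow> real)" where
  "branching_vector Q N C = (\<lambda>\<omega>. (Q \<omega>, N \<omega>, \<lambda>r\<in>{1..}. C r \<omega>))"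

text \<open>\<open>has_law M S X \<mu>\<close>: \<open>X\<close> is a random element of \<open>S\<close> with distribution \<open>\<mu>\<close>. Measurability is
  part of the notion, because \<^const>\<open>distr\<close> is meaningful for measurable maps only.\<close>

definition has_law :: "'a measure \<Rightarrow> 'b measure \<Rightarrow> ('a \<Rightarrow> 'b) \<Rightarrow> 'b measure \<Rightarrow> bool" where
  "has_law M S X \<mu> \<longleftrightarrow> X \<in> measurable M S \<and> distr M S X = \<mu>"

text \<open>\<open>\<rho>\<^sub>\<gamma> = E[\<Sum>\<^sub>i\<^sub>\<le>\<^sub>N |C\<^sub>i|\<^sup>\<gamma>]\<close>, a value in \<open>[0, \<infinity>]\<close>. A Bochner integral would give 0 when the
  expectation is infinite.\<close>

definition rho :: "'a measure \<Rightarrow> ('a \<Rightarrow> nat) \<Rightarrow> (nat \<Rightarrow> 'a \<Rightarrow> real) \<Rightarrow> real \<Rightarrow> ennreal" where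
  "rho M N C \<gamma> = (\<integral>\<^sup>+\<omega>. ennreal (\<Sum>i = 1..N \<omega>. \<bar>C i \<omega>\<bar> powr \<gamma>) \<partial>M)"

section \<open>The process \<open>R\<^sup>(\<^sup>k\<^sup>)\<close> on the weighted branching tree\<close>

text \<open>Nodes are finite sequences of positive integers; \<open>i @ [j]\<close> is the \<open>j\<close>-th child of \<open>i\<close>.\<close>

definition nodes :: "nat list set" where
  "nodes = lists {1..}"

primrec generation :: "(nat list \<Rightarrow> 'a \<Rightarrow> nat) \<Rightarrow> nat \<Rightarrow> 'a \<Rightarrow> nat list set" where
  "generation N 0 \<omega> = {[]}"
| "generation N (Suc n) \<omega> = {i @ [j] | i j. i \<in> generation N n \<omega> \<and> 1 \<le> j \<and> j \<le> N i \<omega>}"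

function path_weight :: "(nat list \<Rightarrow> 'a \<Rightarrow> real) \<Rightarrow> nat list \<Rightarrow> 'a \<Rightarrow> real" where
  "path_weight C [] \<omega> = 1"
| "path_weight C (i @ [j]) \<omega> = C (i @ [j]) \<omega> * path_weight C i \<omega>"
  by (auto intro: rev_exhaust) (metis prod_cases3 rev_exhaust)
termination by (relation "Wellfounded.measure (\<lambda>(C, i, \<omega>). length i)") auto

definition tree_process ::
  "(nat list \<Rightarrow> 'a \<Rightarrow> real) \<Rightarrow> (nat list \<Rightarrow> 'a \<Rightarrow> nat) \<Rightarrow> (nat list \<Rightarrow> 'a \<Rightarrow> real) \<Rightarrow> nat \<Rightarrow> 'a \<Rightarrow> real" where
  "tree_process Q N C k \<omega> = (\<Sum>j = 0..k. \<Sum>i \<in> generation N j \<omega>. Q i \<omega> * path_weight C i \<omega>)"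

text \<open>The vectors \<open>(Q\<^sub>i, N\<^sub>i, C\<^sub>(\<^sub>i\<^sub>,\<^sub>1\<^sub>), C\<^sub>(\<^sub>i\<^sub>,\<^sub>2\<^sub>), \<dots>)\<close>, with \<open>i\<close> ranging over the nodes, are i.i.d. with law \<open>\<mu>\<close>.\<close>

definition branching_tree ::
  "'a measure \<Rightarrow> (real \<times> nat \<times> (nat \<Rightarrow> real)) measure \<Rightarrow>
   (nat list \<Rightarrow> 'a \<Rightarrow> real) \<Rightarrow> (nat list \<Rightarrow> 'a \<Rightarrow> nat) \<Rightarrow> (nat list \<Rightarrow> 'a \<Rightarrow> real) \<Rightarrow> bool" where
  "branching_tree T \<mu> Q N C \<longleftrightarrow>
     prob_space T \<and>
     (\<forall>i\<in>nodes. has_law T branching_space (branching_vector (Q i) (N i) (\<lambda>r. C (i @ [r]))) \<mu>) \<and>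
     prob_space.indep_vars T (\<lambda>_. branching_space)
       (\<lambda>i. branching_vector (Q i) (N i) (\<lambda>r. C (i @ [r]))) nodes"

section \<open>The iterative bootstrap algorithm\<close>

primrec pool ::
  "(nat \<Rightarrow> nat \<Rightarrow> 'a \<Rightarrow> real) \<Rightarrow> (nat \<Rightarrow> nat \<Rightarrow> 'a \<Rightarrow> nat) \<Rightarrow> (nat \<Rightarrow> nat \<Rightarrow> nat \<Rightarrow> 'a \<Rightarrow> real) \<Rightarrow>
   (nat \<Rightarrow> nat \<Rightarrow> nat \<Rightarrow> 'a \<Rightarrow> nat) \<Rightarrow> nat \<Rightarrow> nat \<Rightarrow> 'a \<Rightarrow> real" where
  "pool Q N C J 0 i \<omega> = Q 0 i \<omega>"
| "pool Q N C J (Suc j) i \<omega> =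
     (\<Sum>r = 1..N (Suc j) i \<omega>. C (Suc j) i r \<omega> * pool Q N C J j (J (Suc j) i r \<omega>) \<omega>) + Q (Suc j) i \<omega>"

text \<open>The random inputs of the algorithm take values in different spaces, so their mutual
  independence is expressed through the \<open>\<sigma>\<close>-algebras they generate.\<close>

datatype source =
    Initial nat        \<comment> \<open>\<open>Q\<^sub>i\<close> at level 0\<close>
  | Vector nat nat     \<comment> \<open>level, \<open>i\<close>\<close>
  | Index nat nat nat  \<comment> \<open>level, \<open>i\<close>, \<open>r\<close>\<close>

definition sources :: "nat \<Rightarrow> source set" where
  "sources m =
     {Initial i | i. i \<in> {1..m}} \<union>
     {Vector j i | j i. 1 \<le> j \<and> i \<in> {1..m}} \<union>
     {Index j i r | j i r. 1 \<le> j \<and> i \<in> {1..m} \<and> 1 \<le> r}"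

primrec source_events ::
  "'a measure \<Rightarrow> (nat \<Rightarrow> nat \<Rightarrow> 'a \<Rightarrow> real) \<Rightarrow> (nat \<Rightarrow> nat \<Rightarrow> 'a \<Rightarrow> nat) \<Rightarrow> (nat \<Rightarrow> nat \<Rightarrow> nat \<Rightarrow> 'a \<Rightarrow> real) \<Rightarrow>
   (nat \<Rightarrow> nat \<Rightarrow> nat \<Rightarrow> 'a \<Rightarrow> nat) \<Rightarrow> source \<Rightarrow> 'a set set" where
  "source_events B Q N C J (Initial i) = sets (vimage_algebra (space B) (Q 0 i) borel)"
| "source_events B Q N C J (Vector j i) =
     sets (vimage_algebra (space B) (branching_vector (Q j i) (N j i) (C j i)) branching_space)"
| "source_events B Q N C J (Index j i r) =
     sets (vimage_algebra (space B) (J j i r) (count_space UNIV))"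

text \<open>Admissible inputs for pool size \<open>m\<close>. At level 0 only \<open>Q 0 i\<close> is used, and its law is the
  first marginal of \<open>\<mu>\<close>. Measurability into \<^term>\<open>count_space {1..m}\<close> makes every index lie in
  \<^term>\<open>{1..m}\<close> surely.\<close>

definition bootstrap_inputs ::
  "'a measure \<Rightarrow> (real \<times> nat \<times> (nat \<Rightarrow> real)) measure \<Rightarrow> nat \<Rightarrow>
   (nat \<Rightarrow> nat \<Rightarrow> 'a \<Rightarrow> real) \<Rightarrow> (nat \<Rightarrow> nat \<Rightarrow> 'a \<Rightarrow> nat) \<Rightarrow> (nat \<Rightarrow> nat \<Rightarrow> nat \<Rightarrow> 'a \<Rightarrow> real) \<Rightarrow>
   (nat \<Rightarrow> nat \<Rightarrow> nat \<Rightarrow> 'a \<Rightarrow> nat) \<Rightarrow> bool" where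
  "bootstrap_inputs B \<mu> m Q N C J \<longleftrightarrow>
     prob_space B \<and>
     (\<forall>i\<in>{1..m}. has_law B borel (Q 0 i) (distr \<mu> borel fst)) \<and>
     (\<forall>j\<ge>1. \<forall>i\<in>{1..m}.
        has_law B branching_space (branching_vector (Q j i) (N j i) (C j i)) \<mu>) \<and>
     (\<forall>j\<ge>1. \<forall>i\<in>{1..m}. \<forall>r\<ge>1.
        has_law B (count_space {1..m}) (J j i r) (uniform_count_measure {1..m})) \<and>
     prob_space.indep_sets B (source_events B Q N C J) (sources m)"

section \<open>Convergence in probability\<close>

text \<open>Convergence in probability to a constant, where the \<open>m\<close>-th variable may live on its own
  probability space \<open>B m\<close>. The terms have to be random variables from some index on, since
  otherwise \<^const>\<open>measure\<close> would be 0 on a non-measurable event.\<close>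

definition converges_in_probability ::
  "(nat \<Rightarrow> 'a measure) \<Rightarrow> (nat \<Rightarrow> 'a \<Rightarrow> real) \<Rightarrow> real \<Rightarrow> bool" where
  "converges_in_probability B X c \<longleftrightarrow>
     (\<forall>\<^sub>F m in sequentially. prob_space (B m) \<and> X m \<in> borel_measurable (B m)) \<and>
     (\<forall>\<epsilon>>0. (\<lambda>m. measure (B m) {\<omega> \<in> space (B m). \<bar>X m \<omega> - c\<bar> > \<epsilon>}) \<longlonglongrightarrow> 0)"

end

theory Submission
  imports Defs
begin

text \<open>Given the pool of level \<open>k\<close>, the entries of the pool of level \<open>k + 1\<close> are i.i.d., and the
  characteristic function of their common conditional law is obtained from the empirical
  characteristic function \<open>\<phi>\<close> of the old pool by the map \<open>\<phi> \<mapsto> E[e\<^sup>i\<^sup>t\<^sup>Q \<Prod>\<^sub>r\<^sub>\<le>\<^sub>N \<phi>(t C\<^sub>r)]\<close>. The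
  same map sends the characteristic function of \<open>R\<^sup>(\<^sup>k\<^sup>)\<close> to that of \<open>R\<^sup>(\<^sup>k\<^sup>+\<^sup>1\<^sup>)\<close>. Since the conditional
  variance of an empirical characteristic function is of order \<open>1/m\<close>, induction on \<open>k\<close> and
  dominated convergence show that the empirical characteristic functions converge pointwise in
  \<open>L\<^sup>1\<close>. The \<open>\<beta>\<close>-th absolute moments of the pool are bounded uniformly in \<open>m\<close>; together with
  Levy's continuity theorem this gives the convergence of the averages of \<open>h\<close>.\<close>

section \<open>Decoupling of independent sources\<close>

text \<open>Above level 0 the entries of a pool are dependent, since all of them draw from the same
  earlier pool, so the law of large numbers for i.i.d. variables does not apply to them directly;
  independence returns only once the earlier pool is frozen. Freezing is done without conditional
  expectations: an entry is written as a function of two arguments, \<open>\<omega>\<close> for the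
  old pool and \<open>\<omega>'\<close> for the fresh inputs, and the integral along the diagonal is
  replaced by an iterated integral. Characteristic functions suit this because, for a frozen
  branching vector, the sum over \<open>r\<close> turns into a finite product of factors in the
  closed unit disc, however \<open>Q\<close>, \<open>N\<close> and the weights depend on each other.
  Variances are then bounded by absolute constants although the pool may lack second moments
  (\<open>\<beta>\<close> may be below 2), and a constant dominates in the limit. The moment bounds
  act at the very end. They make \<open>h\<close> uniformly integrable over all measures concerned,
  and they make the characteristic functions equi-Lipschitz, so that finitely many arguments
  \<open>t\<close> decide and a union bound is possible.\<close>

locale independent_sources = prob_space P for P :: "'a measure" +
  fixes E :: "'s \<Rightarrow> 'a set set" and S :: "'s set"
  assumes indep_E: "indep_sets E S"
    and sigma_E: "s \<in> S \<Longrightarrow> sigma_algebra (space P) (E s)"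
begin

text \<open>Intersecting with \<open>S\<close> allows \<open>A\<close> to be any convenient set of
  labels, such as all labels up to some level, without checking which of them are actual
  sources.\<close>

definition gen :: "'s set \<Rightarrow> 'a measure" where
  "gen A = sigma (space P) (\<Union>s\<in>A \<inter> S. E s)"

lemma E_events: "s \<in> S \<Longrightarrow> E s \<subseteq> events"
  using indep_E by (auto simp: indep_sets_def)

lemma E_Pow: "(\<Union>s\<in>A \<inter> S. E s) \<subseteq> Pow (space P)"
  using E_events sets.space_closed by blast

lemma space_gen [simp]: "space (gen A) = space P"
  by (simp add: gen_def space_measure_of_conv)

lemma sets_gen: "sets (gen A) = sigma_sets (space P) (\<Union>s\<in>A \<inter> S. E s)"
  unfolding gen_def using E_Pow by (rule sets_measure_of)

lemma sets_gen_events: "sets (gen A) \<subseteq> events"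
  unfolding sets_gen using E_events by (intro sets.sigma_sets_subset) auto

lemma sets_gen_mono: "A \<subseteq> A' \<Longrightarrow> sets (gen A) \<subseteq> sets (gen A')"
  unfolding sets_gen by (intro sigma_sets_subseteq) auto

lemma measurable_gen_imp: "f \<in> measurable (gen A) N \<Longrightarrow> f \<in> measurable P N"
  using measurable_mono[of N N "gen A" P] sets_gen_events by auto

lemma measurable_gen_mono: "A \<subseteq> A' \<Longrightarrow> f \<in> measurable (gen A) N \<Longrightarrow> f \<in> measurable (gen A') N"
  using measurable_mono[of N N "gen A" "gen A'"] sets_gen_mono by auto

lemma measurable_gen_vimage:
  assumes "s \<in> A" "s \<in> S" "E s = sets (vimage_algebra (space P) f N)" "f \<in> space P \<rightarrow> space N"
  shows "f \<in> measurable (gen A) N"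
proof -
  have "f \<in> measurable (vimage_algebra (space P) f N) N"
    using assms(4) by (rule measurable_vimage_algebra1)
  moreover have "sets (vimage_algebra (space P) f N) \<subseteq> sets (gen A)"
    unfolding sets_gen assms(3)[symmetric] using assms(1,2) by (auto intro: sigma_sets.Basic)
  ultimately show ?thesis
    using measurable_mono[of N N "vimage_algebra (space P) f N" "gen A"] by auto
qed

text \<open>\<open>gen A\<close> is used as a \<sigma>-algebra only. Pushing \<open>P\<close>
  forward along this identity map equips it with the restriction of \<open>P\<close>.\<close>

lemma measurable_ident_gen: "(\<lambda>\<omega>. \<omega>) \<in> measurable P (gen A)"
  using sets_gen_events by (auto simp: measurable_def)

text \<open>Each \<open>E s\<close> is a \<sigma>-algebra, hence stable under intersection, so
  independence passes to the \<sigma>-algebras generated by disjoint groups.\<close>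

lemma indep_sets_gen:
  assumes "disjoint_family_on A I"
  shows "indep_sets (\<lambda>i. sets (gen (A i))) I"
  unfolding sets_gen
proof (rule indep_sets_collect_sigma)
  show "indep_sets E (\<Union>j\<in>I. A j \<inter> S)"
    using indep_E by (rule indep_sets_mono_index[rotated]) auto
  show "Int_stable (E i)" if "j \<in> I" "i \<in> A j \<inter> S" for i j
  proof -
    interpret sigma_algebra "space P" "E i" using that sigma_E by auto
    show ?thesis by (auto simp: Int_stable_def)
  qed
  show "disjoint_family_on (\<lambda>i. A i \<inter> S) I"
    using assms by (auto simp: disjoint_family_on_def)
qed

text \<open>Reduces every later independence claim to measurability with respect to disjoint blocks
  of sources.\<close>

lemma indep_vars_gen:
  assumes "disjoint_family_on A I" and X: "\<And>i. i \<in> I \<Longrightarrow> X i \<in> measurable (gen (A i)) (N i)"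
  shows "indep_vars N X I"
  unfolding indep_vars_def2
proof (intro conjI ballI)
  show "random_variable (N i) (X i)" if "i \<in> I" for i
    using X[OF that] by (rule measurable_gen_imp)
  show "indep_sets (\<lambda>i. {X i -` B \<inter> space P | B. B \<in> sets (N i)}) I"
  proof (rule indep_sets_mono_sets[OF indep_sets_gen[OF assms(1)]])
    show "{X i -` B \<inter> space P | B. B \<in> sets (N i)} \<subseteq> sets (gen (A i))" if "i \<in> I" for i
      using measurable_sets[OF X[OF that]] by auto
  qed
qed

text \<open>Independence makes the diagonal map measure preserving into the product of the two
  restrictions of \<^term>\<open>P\<close>, so the two arguments of a function may be decoupled.\<close>

lemma distr_diagonal:
  assumes "A \<inter> A' = {}"
  shows "distr P (gen A) (\<lambda>\<omega>. \<omega>) \<Otimes>\<^sub>M distr P (gen A') (\<lambda>\<omega>. \<omega>)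
    = distr P (gen A \<Otimes>\<^sub>M gen A') (\<lambda>\<omega>. (\<omega>, \<omega>))"
proof -
  have "indep_vars (\<lambda>b. case_bool (gen A) (gen A') b) (\<lambda>b \<omega>. \<omega>) (UNIV :: bool set)"
    using assms by (intro indep_vars_gen[of "case_bool A A'"])
      (auto simp: disjoint_family_on_def split: bool.split)
  then have "indep_var (gen A) (\<lambda>\<omega>. \<omega>) (gen A') (\<lambda>\<omega>. \<omega>)"
    unfolding indep_var_def
    by (rule indep_vars_cong[THEN iffD1, rotated -1]) (auto split: bool.split)
  then show ?thesis
    unfolding indep_var_distribution_eq by auto
qed

text \<open>The substitute for conditioning on \<open>gen A\<close>: in the inner integral
  \<open>\<omega>\<close> is frozen and only the sources in \<open>A'\<close> are random.
  Measurability on the product records that each argument uses its own block only.\<close>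

lemma decouple_nn_integral:
  assumes "A \<inter> A' = {}" and [measurable]: "f \<in> borel_measurable (gen A \<Otimes>\<^sub>M gen A')"
  shows "(\<integral>\<^sup>+\<omega>. f (\<omega>, \<omega>) \<partial>P) = (\<integral>\<^sup>+\<omega>. \<integral>\<^sup>+\<omega>'. f (\<omega>, \<omega>') \<partial>P \<partial>P)"
proof -
  note [measurable] = measurable_ident_gen
  let ?D = "\<lambda>A. distr P (gen A) (\<lambda>\<omega>. \<omega>)"
  interpret D: prob_space "?D B" for B
    by (rule prob_space_distr) simp
  have "(\<integral>\<^sup>+\<omega>. f (\<omega>, \<omega>) \<partial>P) = (\<integral>\<^sup>+p. f p \<partial>distr P (gen A \<Otimes>\<^sub>M gen A') (\<lambda>\<omega>. (\<omega>, \<omega>)))"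
    by (subst nn_integral_distr) auto
  also have "\<dots> = (\<integral>\<^sup>+p. f p \<partial>(?D A \<Otimes>\<^sub>M ?D A'))"
    by (simp add: distr_diagonal[OF assms(1)])
  also have "\<dots> = (\<integral>\<^sup>+\<omega>. \<integral>\<^sup>+\<omega>'. f (\<omega>, \<omega>') \<partial>?D A' \<partial>?D A)"
    by (subst D.nn_integral_fst[symmetric]) auto
  also have "\<dots> = (\<integral>\<^sup>+\<omega>. \<integral>\<^sup>+\<omega>'. f (\<omega>, \<omega>') \<partial>?D A' \<partial>P)"
    by (subst nn_integral_distr) (auto intro!: D.borel_measurable_nn_integral)
  also have "\<dots> = (\<integral>\<^sup>+\<omega>. \<integral>\<^sup>+\<omega>'. f (\<omega>, \<omega>') \<partial>P \<partial>P)"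
    by (intro nn_integral_cong nn_integral_distr) auto
  finally show ?thesis .
qed

lemma decouple_integral:
  fixes f :: "'a \<times> 'a \<Rightarrow> 'b::{banach, second_countable_topology}"
  assumes "A \<inter> A' = {}" and [measurable]: "f \<in> borel_measurable (gen A \<Otimes>\<^sub>M gen A')"
    and bound: "\<And>p. norm (f p) \<le> c"
  shows "(\<integral>\<omega>. f (\<omega>, \<omega>) \<partial>P) = (\<integral>\<omega>. \<integral>\<omega>'. f (\<omega>, \<omega>') \<partial>P \<partial>P)"
proof -
  note [measurable] = measurable_ident_gen
  let ?D = "\<lambda>A. distr P (gen A) (\<lambda>\<omega>. \<omega>)"
  interpret D: prob_space "?D B" for B
    by (rule prob_space_distr) simp
  interpret DD: pair_prob_space "?D A" "?D A'" ..
  have int: "integrable (?D A \<Otimes>\<^sub>M ?D A') f"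
    by (rule DD.P.integrable_const_bound[where B = c]) (auto intro: bound)
  have "(\<integral>\<omega>. f (\<omega>, \<omega>) \<partial>P) = (\<integral>p. f p \<partial>distr P (gen A \<Otimes>\<^sub>M gen A') (\<lambda>\<omega>. (\<omega>, \<omega>)))"
    by (subst integral_distr) auto
  also have "\<dots> = (\<integral>p. f p \<partial>(?D A \<Otimes>\<^sub>M ?D A'))"
    by (simp add: distr_diagonal[OF assms(1)])
  also have "\<dots> = (\<integral>\<omega>. \<integral>\<omega>'. f (\<omega>, \<omega>') \<partial>?D A' \<partial>?D A)"
    by (rule DD.integral_fst'[OF int, symmetric])
  also have "\<dots> = (\<integral>\<omega>. \<integral>\<omega>'. f (\<omega>, \<omega>') \<partial>?D A' \<partial>P)"
    by (subst integral_distr) (auto intro!: D.borel_measurable_lebesgue_integral)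
  also have "\<dots> = (\<integral>\<omega>. \<integral>\<omega>'. f (\<omega>, \<omega>') \<partial>P \<partial>P)"
    by (intro Bochner_Integration.integral_cong integral_distr refl) auto
  finally show ?thesis .
qed

end

section \<open>Sums over a branching vector\<close>

definition branch_sum :: "real \<times> nat \<times> (nat \<Rightarrow> real) \<Rightarrow> (nat \<Rightarrow> real) \<Rightarrow> real" where
  "branch_sum v y = (\<Sum>r = 1..fst (snd v). snd (snd v) r * y r) + fst v"

definition weight_sum :: "real \<times> nat \<times> (nat \<Rightarrow> real) \<Rightarrow> real" where
  "weight_sum v = (\<Sum>r = 1..fst (snd v). \<bar>snd (snd v) r\<bar>)"

text \<open>For a frozen vector \<open>v = (Q, N, C)\<close> this is the characteristic function at
  \<open>t\<close> of \<open>branch_sum v Y\<close> when the \<open>Y r\<close> are independent with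
  characteristic function \<open>\<phi>\<close>.\<close>

definition branch_char :: "(real \<Rightarrow> complex) \<Rightarrow> real \<Rightarrow> real \<times> nat \<times> (nat \<Rightarrow> real) \<Rightarrow> complex" where
  "branch_char \<phi> t v = iexp (t * fst v) * (\<Prod>r = 1..fst (snd v). \<phi> (t * snd (snd v) r))"

lemma branch_sum_branching_vector:
  "branch_sum (branching_vector Q N C \<omega>) y = (\<Sum>r = 1..N \<omega>. C r \<omega> * y r) + Q \<omega>"
  by (simp add: branch_sum_def branching_vector_def)

lemma weight_sum_nonneg: "0 \<le> weight_sum v"
  by (simp add: weight_sum_def sum_nonneg)

lemma measurable_branching_space_fst [measurable]: "fst \<in> borel_measurable branching_space"
  by (simp add: branching_space_def)

lemma measurable_branching_space_count [measurable]:
  "(\<lambda>v. fst (snd v)) \<in> measurable branching_space (count_space UNIV)"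
  by (simp add: branching_space_def)

lemma measurable_branching_space_weight:
  assumes "V \<in> measurable M branching_space" "r \<ge> 1"
  shows "(\<lambda>\<omega>. snd (snd (V \<omega>)) r) \<in> borel_measurable M"
proof -
  have "r \<in> {1..}"
    using assms(2) by simp
  then have "(\<lambda>v. snd (snd v) r) \<in> borel_measurable branching_space"
    unfolding branching_space_def by measurable
  then show ?thesis
    by (rule measurable_compose[OF assms(1)])
qed

text \<open>The upper summation limit is random. For each fixed limit \<open>n\<close> the sum is
  measurable, and the count takes countably many values, so the pieces can be glued.\<close>

lemma measurable_branch_sum:
  assumes V: "V \<in> measurable M branching_space"
    and Y: "\<And>r. r \<ge> 1 \<Longrightarrow> Y r \<in> borel_measurable M"
  shows "(\<lambda>\<omega>. branch_sum (V \<omega>) (\<lambda>r. Y r \<omega>)) \<in> borel_measurable M"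
proof -
  note [measurable] = V
  have "(\<lambda>\<omega>. \<Sum>r = 1..n. snd (snd (V \<omega>)) r * Y r \<omega>) \<in> borel_measurable M" for n
    by (intro borel_measurable_sum borel_measurable_times
        measurable_branching_space_weight[OF V] Y) simp_all
  then have "(\<lambda>\<omega>. \<Sum>r = 1..fst (snd (V \<omega>)). snd (snd (V \<omega>)) r * Y r \<omega>) \<in> borel_measurable M"
    by (rule measurable_compose_countable[where g = "\<lambda>\<omega>. fst (snd (V \<omega>))"]) measurable
  then show ?thesis
    unfolding branch_sum_def by simp
qed

lemma measurable_weight_sum [measurable]: "weight_sum \<in> borel_measurable branching_space"
proof -
  have "(\<lambda>v. \<Sum>r = 1..n. \<bar>snd (snd v) r\<bar>) \<in> borel_measurable branching_space" for n
    by (intro borel_measurable_sum borel_measurable_abs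
        measurable_branching_space_weight[where V = "\<lambda>v. v"]) simp_all
  then show ?thesis
    unfolding weight_sum_def[abs_def]
    by (rule measurable_compose_countable[where g = "\<lambda>v. fst (snd v)"]) measurable
qed

text \<open>\<open>\<phi>\<close> may itself be random, as it is for the empirical characteristic
  function of a pool; the second assumption is joint measurability, stated through substitution of a
  measurable argument.\<close>

lemma measurable_branch_char:
  assumes V: "V \<in> measurable M branching_space"
    and \<phi>: "\<And>t f. f \<in> borel_measurable M \<Longrightarrow> (\<lambda>\<omega>. \<phi> \<omega> (f \<omega>)) \<in> borel_measurable M"
  shows "(\<lambda>\<omega>. branch_char (\<phi> \<omega>) t (V \<omega>)) \<in> borel_measurable M"
proof -
  note [measurable] = V
  have "(\<lambda>\<omega>. \<Prod>r = 1..n. \<phi> \<omega> (t * snd (snd (V \<omega>)) r)) \<in> borel_measurable M" for n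
    by (intro borel_measurable_prod \<phi> borel_measurable_times borel_measurable_const
        measurable_branching_space_weight[OF V]) simp_all
  then have "(\<lambda>\<omega>. \<Prod>r = 1..fst (snd (V \<omega>)). \<phi> \<omega> (t * snd (snd (V \<omega>)) r)) \<in> borel_measurable M"
    by (rule measurable_compose_countable[where g = "\<lambda>\<omega>. fst (snd (V \<omega>))"]) measurable
  then show ?thesis
    unfolding branch_char_def by measurable
qed

lemma norm_branch_char_le_1:
  assumes "\<And>t. norm (\<phi> t) \<le> 1"
  shows "norm (branch_char \<phi> t v) \<le> 1"
proof -
  have "norm (branch_char \<phi> t v) = (\<Prod>r = 1..fst (snd v). norm (\<phi> (t * snd (snd v) r)))"
    by (simp add: branch_char_def norm_mult prod_norm)
  also have "\<dots> \<le> 1"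
    by (rule prod_le_1) (auto intro: assms)
  finally show ?thesis .
qed

text \<open>With the constant function 1 the product in \<open>branch_char\<close> disappears, so
  the first factor is just the contribution of \<open>Q\<close>, which does not involve
  \<open>y\<close>.\<close>

lemma iexp_branch_sum: "iexp (t * branch_sum v y) = branch_char (\<lambda>s. 1) t v *
    (\<Prod>r = 1..fst (snd v). iexp (t * snd (snd v) r * y r))"
  by (simp add: branch_sum_def branch_char_def algebra_simps sum_distrib_left exp_add exp_sum)

section \<open>Moment inequalities for weighted sums\<close>

text \<open>Jensen's inequality for the power \<open>\<beta>\<close> with probability weights
  \<open>c i / sum c I\<close>, multiplied by the \<open>\<beta>\<close>-th power of the total
  weight. The weights remain linear in the last sum, so bounding every
  \<open>y i powr \<beta>\<close> by a constant \<open>b\<close> leaves exactly the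
  \<open>\<beta>\<close>-th power of the total weight times \<open>b\<close>.\<close>

lemma sum_powr_le:
  fixes c y :: "'i \<Rightarrow> real"
  assumes "finite I" "\<beta> > 1" and c: "\<And>i. i \<in> I \<Longrightarrow> 0 \<le> c i" and y: "\<And>i. i \<in> I \<Longrightarrow> 0 \<le> y i"
  shows "(\<Sum>i\<in>I. c i * y i) powr \<beta> \<le> (\<Sum>i\<in>I. c i) powr (\<beta> - 1) * (\<Sum>i\<in>I. c i * y i powr \<beta>)"
proof -
  \<comment> \<open>The library states convexity of powers only on the open half-line.\<close>
  define J where "J = {i \<in> I. c i \<noteq> 0 \<and> y i \<noteq> 0}"
  define s where "s = sum c J"
  have fin: "finite J" and cJ: "\<And>i. i \<in> J \<Longrightarrow> 0 < c i" and yJ: "\<And>i. i \<in> J \<Longrightarrow> 0 < y i" and "J \<subseteq> I"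
    using assms by (auto simp: J_def less_le)
  have sum_J: "(\<Sum>i\<in>I. c i * y i) = (\<Sum>i\<in>J. c i * y i)"
    using assms(1) by (intro sum.mono_neutral_right) (auto simp: J_def)
  show ?thesis
  proof (cases "J = {}")
    case True
    then show ?thesis
      using c by (auto simp: sum_J intro!: mult_nonneg_nonneg sum_nonneg)
  next
    case False
    then have s: "0 < s"
      using fin cJ by (auto simp: s_def intro!: sum_pos)
    have "(\<Sum>i\<in>J. (c i / s) *\<^sub>R y i) powr \<beta> \<le> (\<Sum>i\<in>J. (c i / s) * y i powr \<beta>)"
    proof (rule convex_on_sum[OF fin False powr_convex])
      show "(\<Sum>i\<in>J. c i / s) = 1"
        using s by (simp add: s_def flip: sum_divide_distrib)
    qed (use assms(2) s cJ yJ in \<open>auto intro: less_imp_le\<close>)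
    then have *: "((\<Sum>i\<in>J. c i * y i) / s) powr \<beta> \<le> (\<Sum>i\<in>J. c i * y i powr \<beta>) / s"
      by (simp add: sum_divide_distrib)
    have "(\<Sum>i\<in>J. c i * y i) powr \<beta> = ((\<Sum>i\<in>J. c i * y i) / s) powr \<beta> * s powr \<beta>"
      using s cJ yJ by (simp add: powr_divide less_imp_le sum_nonneg)
    also have "\<dots> \<le> (\<Sum>i\<in>J. c i * y i powr \<beta>) / s * s powr \<beta>"
      by (intro mult_right_mono *) simp
    also have "\<dots> = s powr (\<beta> - 1) * (\<Sum>i\<in>J. c i * y i powr \<beta>)"
      using s by (simp add: powr_diff)
    also have "\<dots> \<le> (\<Sum>i\<in>I. c i) powr (\<beta> - 1) * (\<Sum>i\<in>I. c i * y i powr \<beta>)"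
      using s assms \<open>J \<subseteq> I\<close> unfolding s_def
      by (intro mult_mono powr_mono2 sum_mono2) (auto intro!: sum_nonneg simp: J_def)
    finally show ?thesis
      by (simp add: sum_J)
  qed
qed

lemma abs_add_powr_le:
  fixes a b :: real
  assumes "\<beta> \<ge> 0"
  shows "\<bar>a + b\<bar> powr \<beta> \<le> 2 powr \<beta> * (\<bar>a\<bar> powr \<beta> + \<bar>b\<bar> powr \<beta>)"
proof -
  have "\<bar>a + b\<bar> powr \<beta> \<le> (2 * max \<bar>a\<bar> \<bar>b\<bar>) powr \<beta>"
    using assms by (intro powr_mono2) auto
  also have "\<dots> = 2 powr \<beta> * max (\<bar>a\<bar> powr \<beta>) (\<bar>b\<bar> powr \<beta>)"
    using assms by (auto simp: powr_mult max_def) (smt (verit) powr_mono2)+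
  also have "\<dots> \<le> 2 powr \<beta> * (\<bar>a\<bar> powr \<beta> + \<bar>b\<bar> powr \<beta>)"
    by (intro mult_left_mono) auto
  finally show ?thesis .
qed

text \<open>The right-hand side is linear in the powers of \<open>\<bar>y r\<bar>\<close>, so
  integrating over a random \<open>y\<close> calls for nothing but the individual moments.\<close>

lemma branch_sum_powr_le:
  assumes "\<beta> > 1"
  shows "\<bar>branch_sum v y\<bar> powr \<beta> \<le> 2 powr \<beta> *
    (\<bar>fst v\<bar> powr \<beta> + weight_sum v powr (\<beta> - 1) *
      (\<Sum>r = 1..fst (snd v). \<bar>snd (snd v) r\<bar> * \<bar>y r\<bar> powr \<beta>))"
proof -
  let ?s = "\<Sum>r = 1..fst (snd v). snd (snd v) r * y r"
  have "\<bar>?s\<bar> powr \<beta> \<le> (\<Sum>r = 1..fst (snd v). \<bar>snd (snd v) r\<bar> * \<bar>y r\<bar>) powr \<beta>"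
    using assms by (intro powr_mono2 order_trans[OF sum_abs]) (auto simp: abs_mult)
  also have "\<dots> \<le> weight_sum v powr (\<beta> - 1) *
      (\<Sum>r = 1..fst (snd v). \<bar>snd (snd v) r\<bar> * \<bar>y r\<bar> powr \<beta>)"
    unfolding weight_sum_def using assms by (intro sum_powr_le) auto
  finally have *: "\<bar>?s\<bar> powr \<beta> \<le> \<dots>" .
  have "\<bar>branch_sum v y\<bar> powr \<beta> \<le> 2 powr \<beta> * (\<bar>?s\<bar> powr \<beta> + \<bar>fst v\<bar> powr \<beta>)"
    unfolding branch_sum_def using assms by (intro abs_add_powr_le) auto
  also have "\<dots> \<le> 2 powr \<beta> * (\<bar>fst v\<bar> powr \<beta> + weight_sum v powr (\<beta> - 1) *
      (\<Sum>r = 1..fst (snd v). \<bar>snd (snd v) r\<bar> * \<bar>y r\<bar> powr \<beta>))"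
    using * by (intro mult_left_mono) auto
  finally show ?thesis .
qed

section \<open>Transforms and moments of a branching sum with independent inputs\<close>

context independent_sources
begin

text \<open>Block 0 carries the branching vector and block \<open>r\<close> the input
  \<open>Y r\<close>. Merging all blocks \<open>r \<ge> 1\<close> into one gives the two premises
  for decoupling the vector from its inputs.\<close>

lemma decouple_branch_sum:
  assumes A: "disjoint_family A" and V: "V \<in> measurable (gen (A 0)) branching_space"
    and Y: "\<And>r. r \<ge> 1 \<Longrightarrow> Y r \<in> borel_measurable (gen (A r))"
  shows "A 0 \<inter> (\<Union>r\<in>{1..}. A r) = {}"
    "(\<lambda>p. branch_sum (V (fst p)) (\<lambda>r. Y r (snd p)))
       \<in> borel_measurable (gen (A 0) \<Otimes>\<^sub>M gen (\<Union>r\<in>{1..}. A r))"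
proof -
  show "A 0 \<inter> (\<Union>r\<in>{1..}. A r) = {}"
  proof -
    have "A 0 \<inter> A r = {}" if "r \<ge> 1" for r
      using disjoint_family_onD[OF A, of 0 r] that by simp
    then show ?thesis by blast
  qed
  have "Y r \<in> borel_measurable (gen (\<Union>r\<in>{1..}. A r))" if "r \<ge> 1" for r
    by (rule measurable_gen_mono[OF _ Y[OF that]]) (use that in auto)
  then show "(\<lambda>p. branch_sum (V (fst p)) (\<lambda>r. Y r (snd p)))
       \<in> borel_measurable (gen (A 0) \<Otimes>\<^sub>M gen (\<Union>r\<in>{1..}. A r))"
    by (intro measurable_branch_sum[where V = "\<lambda>p. V (fst p)" and Y = "\<lambda>r p. Y r (snd p)"])
      (simp_all add: measurable_compose[OF measurable_fst V] measurable_compose[OF measurable_snd])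
qed

text \<open>Once the vector is frozen, its count and weights are constants, finitely many
  independent factors remain, and the expectation of their product splits.\<close>

lemma integral_iexp_branch_sum:
  assumes A: "disjoint_family A" and V: "V \<in> measurable (gen (A 0)) branching_space"
    and Y: "\<And>r. r \<ge> 1 \<Longrightarrow> Y r \<in> borel_measurable (gen (A r))"
    and \<phi>: "\<And>r s. r \<ge> 1 \<Longrightarrow> (\<integral>\<omega>. iexp (s * Y r \<omega>) \<partial>P) = \<phi> s"
  shows "(\<integral>\<omega>. iexp (t * branch_sum (V \<omega>) (\<lambda>r. Y r \<omega>)) \<partial>P) = (\<integral>\<omega>. branch_char \<phi> t (V \<omega>) \<partial>P)"
proof -
  note D = decouple_branch_sum[OF A V Y]
  have m: "(\<lambda>p. iexp (t * branch_sum (V (fst p)) (\<lambda>r. Y r (snd p))))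
      \<in> borel_measurable (gen (A 0) \<Otimes>\<^sub>M gen (\<Union>r\<in>{1..}. A r))"
    using D(2) by measurable
  have "(\<integral>\<omega>. iexp (t * branch_sum (V \<omega>) (\<lambda>r. Y r \<omega>)) \<partial>P)
    = (\<integral>\<omega>. \<integral>\<omega>'. iexp (t * branch_sum (V \<omega>) (\<lambda>r. Y r \<omega>')) \<partial>P \<partial>P)"
    using decouple_integral[OF D(1), of "\<lambda>p. iexp (t * branch_sum (V (fst p)) (\<lambda>r. Y r (snd p)))" 1]
    by (simp only: fst_conv snd_conv m norm_exp_i_times order_refl simp_thms)
  also have "\<dots> = (\<integral>\<omega>. branch_char \<phi> t (V \<omega>) \<partial>P)"
  proof (rule Bochner_Integration.integral_cong[OF refl])
    fix \<omega>
    let ?n = "fst (snd (V \<omega>))" and ?c = "snd (snd (V \<omega>))"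
    have meas: "(\<lambda>\<omega>'. iexp (t * ?c r * Y r \<omega>')) \<in> borel_measurable (gen (A r))" if "r \<ge> 1" for r
      using Y[OF that] by measurable
    have "indep_vars (\<lambda>_. borel) (\<lambda>r \<omega>'. iexp (t * ?c r * Y r \<omega>')) {1..?n}"
      using A by (intro indep_vars_gen[of A] meas) (auto simp: disjoint_family_on_def)
    then have "(\<integral>\<omega>'. (\<Prod>r = 1..?n. iexp (t * ?c r * Y r \<omega>')) \<partial>P)
      = (\<Prod>r = 1..?n. \<integral>\<omega>'. iexp (t * ?c r * Y r \<omega>') \<partial>P)"
      using meas by (intro indep_vars_lebesgue_integral integrable_const_bound[where B = 1])
        (auto intro: measurable_gen_imp)
    also have "\<dots> = (\<Prod>r = 1..?n. \<phi> (t * ?c r))"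
      by (intro prod.cong refl \<phi>) simp
    finally show "(\<integral>\<omega>'. iexp (t * branch_sum (V \<omega>) (\<lambda>r. Y r \<omega>')) \<partial>P) = branch_char \<phi> t (V \<omega>)"
      unfolding iexp_branch_sum by (simp add: branch_char_def)
  qed
  finally show ?thesis .
qed

text \<open>Freeze the vector, apply the convexity bound, integrate the linear expression in the
  powers of \<open>\<bar>Y r\<bar>\<close>, and only then integrate over the vector. Here
  \<open>b\<close> lives in \<open>ennreal\<close>, so no integrability of the inputs has to be
  established beforehand.\<close>

lemma nn_integral_branch_sum_powr:
  assumes A: "disjoint_family A" and V: "V \<in> measurable (gen (A 0)) branching_space"
    and Y: "\<And>r. r \<ge> 1 \<Longrightarrow> Y r \<in> borel_measurable (gen (A r))"
    and \<beta>: "\<beta> > 1" and b: "\<And>r. r \<ge> 1 \<Longrightarrow> (\<integral>\<^sup>+\<omega>. \<bar>Y r \<omega>\<bar> powr \<beta> \<partial>P) \<le> b"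
  shows "(\<integral>\<^sup>+\<omega>. \<bar>branch_sum (V \<omega>) (\<lambda>r. Y r \<omega>)\<bar> powr \<beta> \<partial>P) \<le>
    ennreal (2 powr \<beta>) *
      ((\<integral>\<^sup>+\<omega>. \<bar>fst (V \<omega>)\<bar> powr \<beta> \<partial>P) + (\<integral>\<^sup>+\<omega>. weight_sum (V \<omega>) powr \<beta> \<partial>P) * b)"
proof -
  note D = decouple_branch_sum[OF A V Y]
  have mV: "V \<in> measurable P branching_space"
    using V by (rule measurable_gen_imp)
  have mY: "(\<lambda>\<omega>. ennreal (\<bar>Y r \<omega>\<bar> powr \<beta>)) \<in> borel_measurable P" if "r \<ge> 1" for r
    using measurable_gen_imp[OF Y[OF that]] by measurable
  have m: "(\<lambda>p. ennreal (\<bar>branch_sum (V (fst p)) (\<lambda>r. Y r (snd p))\<bar> powr \<beta>))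
      \<in> borel_measurable (gen (A 0) \<Otimes>\<^sub>M gen (\<Union>r\<in>{1..}. A r))"
    using D(2) by measurable
  have "(\<integral>\<^sup>+\<omega>. \<bar>branch_sum (V \<omega>) (\<lambda>r. Y r \<omega>)\<bar> powr \<beta> \<partial>P)
    = (\<integral>\<^sup>+\<omega>. \<integral>\<^sup>+\<omega>'. \<bar>branch_sum (V \<omega>) (\<lambda>r. Y r \<omega>')\<bar> powr \<beta> \<partial>P \<partial>P)"
    using decouple_nn_integral[OF D(1),
        of "\<lambda>p. ennreal (\<bar>branch_sum (V (fst p)) (\<lambda>r. Y r (snd p))\<bar> powr \<beta>)"] m
    by (simp only: fst_conv snd_conv simp_thms)
  also have "\<dots> \<le> (\<integral>\<^sup>+\<omega>. ennreal (2 powr \<beta>) *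
      (ennreal (\<bar>fst (V \<omega>)\<bar> powr \<beta>) + ennreal (weight_sum (V \<omega>) powr \<beta>) * b) \<partial>P)"
  proof (rule nn_integral_mono)
    fix \<omega>
    let ?n = "fst (snd (V \<omega>))" and ?c = "snd (snd (V \<omega>))" and ?w = "weight_sum (V \<omega>)"
    have "(\<integral>\<^sup>+\<omega>'. \<bar>branch_sum (V \<omega>) (\<lambda>r. Y r \<omega>')\<bar> powr \<beta> \<partial>P)
      \<le> (\<integral>\<^sup>+\<omega>'. ennreal (2 powr \<beta>) * (ennreal (\<bar>fst (V \<omega>)\<bar> powr \<beta>) + ennreal (?w powr (\<beta> - 1)) *
          (\<Sum>r = 1..?n. ennreal \<bar>?c r\<bar> * ennreal (\<bar>Y r \<omega>'\<bar> powr \<beta>))) \<partial>P)"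
      using branch_sum_powr_le[OF \<beta>, of "V \<omega>"]
      by (intro nn_integral_mono)
        (simp flip: ennreal_mult' ennreal_plus add: sum_nonneg sum_ennreal)
    also have "\<dots> = ennreal (2 powr \<beta>) * (ennreal (\<bar>fst (V \<omega>)\<bar> powr \<beta>) + ennreal (?w powr (\<beta> - 1)) *
          (\<Sum>r = 1..?n. ennreal \<bar>?c r\<bar> * (\<integral>\<^sup>+\<omega>'. \<bar>Y r \<omega>'\<bar> powr \<beta> \<partial>P)))"
    proof -
      have mS: "(\<lambda>\<omega>'. \<Sum>r = 1..?n. ennreal \<bar>?c r\<bar> * ennreal (\<bar>Y r \<omega>'\<bar> powr \<beta>)) \<in> borel_measurable P"
        by (intro borel_measurable_sum borel_measurable_times_ennreal borel_measurable_const mY) simp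
      have "(\<integral>\<^sup>+\<omega>'. (\<Sum>r = 1..?n. ennreal \<bar>?c r\<bar> * ennreal (\<bar>Y r \<omega>'\<bar> powr \<beta>)) \<partial>P)
        = (\<Sum>r = 1..?n. \<integral>\<^sup>+\<omega>'. ennreal \<bar>?c r\<bar> * ennreal (\<bar>Y r \<omega>'\<bar> powr \<beta>) \<partial>P)"
        by (intro nn_integral_sum borel_measurable_times_ennreal borel_measurable_const mY) simp
      also have "\<dots> = (\<Sum>r = 1..?n. ennreal \<bar>?c r\<bar> * (\<integral>\<^sup>+\<omega>'. \<bar>Y r \<omega>'\<bar> powr \<beta> \<partial>P))"
        by (intro sum.cong refl nn_integral_cmult mY) simp
      finally show ?thesis
        using mS by (simp add: nn_integral_cmult nn_integral_add emeasure_space_1)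
    qed
    also have "\<dots> \<le> ennreal (2 powr \<beta>) * (ennreal (\<bar>fst (V \<omega>)\<bar> powr \<beta>) + ennreal (?w powr (\<beta> - 1)) *
          (\<Sum>r = 1..?n. ennreal \<bar>?c r\<bar> * b))"
      by (intro mult_left_mono add_left_mono sum_mono b) auto
    also have "(\<Sum>r = 1..?n. ennreal \<bar>?c r\<bar> * b) = ennreal ?w * b"
      unfolding weight_sum_def by (simp add: sum_distrib_right flip: sum_ennreal)
    also have "ennreal (?w powr (\<beta> - 1)) * (ennreal ?w * b) = ennreal (?w powr \<beta>) * b"
    proof -
      \<comment> \<open>Zero weight is a separate case: there both sides are 0, because
        \<open>0 powr x = 0\<close>.\<close>
      have "?w powr (\<beta> - 1) * ?w = ?w powr \<beta>"
        using \<beta> weight_sum_nonneg[of "V \<omega>"] by (cases "?w = 0") (simp_all add: powr_diff)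
      then show ?thesis
        by (simp add: weight_sum_nonneg flip: mult.assoc ennreal_mult')
    qed
    finally show "(\<integral>\<^sup>+\<omega>'. \<bar>branch_sum (V \<omega>) (\<lambda>r. Y r \<omega>')\<bar> powr \<beta> \<partial>P) \<le>
      ennreal (2 powr \<beta>) * (ennreal (\<bar>fst (V \<omega>)\<bar> powr \<beta>) + ennreal (?w powr \<beta>) * b)" .
  qed
  also have "\<dots> = ennreal (2 powr \<beta>) *
      ((\<integral>\<^sup>+\<omega>. \<bar>fst (V \<omega>)\<bar> powr \<beta> \<partial>P) + (\<integral>\<^sup>+\<omega>. weight_sum (V \<omega>) powr \<beta> \<partial>P) * b)"
    using mV by (simp add: nn_integral_cmult nn_integral_add nn_integral_multc)
  finally show ?thesis .
qed

end

section \<open>From characteristic functions to integrals\<close>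

text \<open>Truncation at level \<open>L\<close>. Composed with a continuous function of linear
  growth it yields a bounded continuous one, to which weak convergence applies.\<close>

definition clip :: "real \<Rightarrow> real \<Rightarrow> real" where
  "clip L y = max (- L) (min L y)"

lemma abs_clip_le: "0 \<le> L \<Longrightarrow> \<bar>clip L y\<bar> \<le> L"
  by (auto simp: clip_def)

text \<open>Where clipping acts, the error is at most \<open>\<bar>y\<bar>\<close>, which is
  \<open>\<bar>y\<bar> powr \<beta>\<close> times \<open>\<bar>y\<bar> powr (1 - \<beta>)\<close>;
  the latter exponent is negative and \<open>\<bar>y\<bar> > L\<close>.\<close>

lemma clip_error:
  assumes "L > 0" "\<beta> > 1"
  shows "\<bar>y - clip L y\<bar> \<le> \<bar>y\<bar> powr \<beta> * L powr (1 - \<beta>)"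
proof (cases "\<bar>y\<bar> \<le> L")
  case True
  then have "clip L y = y" by (auto simp: clip_def)
  then show ?thesis by simp
next
  case False
  then have "\<bar>y - clip L y\<bar> \<le> \<bar>y\<bar> powr \<beta> * \<bar>y\<bar> powr (1 - \<beta>)"
    using assms by (auto simp: clip_def simp flip: powr_add)
  also have "\<dots> \<le> \<bar>y\<bar> powr \<beta> * L powr (1 - \<beta>)"
    using assms False by (intro mult_left_mono powr_mono2') auto
  finally show ?thesis .
qed

lemma (in real_distribution) moment_bounded:
  assumes "(\<integral>\<^sup>+x. \<bar>x\<bar> powr \<beta> \<partial>M) \<le> ennreal A" "A \<ge> 0"
  shows "integrable M (\<lambda>x. \<bar>x\<bar> powr \<beta>)" "(\<integral>x. \<bar>x\<bar> powr \<beta> \<partial>M) \<le> A"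
proof -
  show *: "integrable M (\<lambda>x. \<bar>x\<bar> powr \<beta>)"
    using assms(1) by (intro integrableI_bounded) (auto simp: le_less_trans)
  show "(\<integral>x. \<bar>x\<bar> powr \<beta> \<partial>M) \<le> A"
    using assms * by (simp add: nn_integral_eq_integral)
qed

lemma linear_growth_powr_le:
  fixes h :: "real \<Rightarrow> real"
  assumes h: "\<And>x. \<bar>h x\<bar> \<le> K * (1 + \<bar>x\<bar>)" and "\<beta> > 1" "K > 0"
  shows "\<bar>h x\<bar> powr \<beta> \<le> (2 * K) powr \<beta> * (1 + \<bar>x\<bar> powr \<beta>)"
proof -
  have "\<bar>h x\<bar> powr \<beta> \<le> (K * (1 + \<bar>x\<bar>)) powr \<beta>"
    using h assms(2) by (intro powr_mono2) auto
  also have "\<dots> = K powr \<beta> * \<bar>1 + \<bar>x\<bar>\<bar> powr \<beta>"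
    using assms by (simp add: powr_mult)
  also have "\<dots> \<le> K powr \<beta> * (2 powr \<beta> * (\<bar>1\<bar> powr \<beta> + \<bar>\<bar>x\<bar>\<bar> powr \<beta>))"
    using assms by (intro mult_left_mono abs_add_powr_le) auto
  finally show ?thesis
    using assms by (simp add: powr_mult mult_ac)
qed

text \<open>The error bound sees the measure through \<open>A\<close> alone and tends to 0 as
  \<open>L\<close> grows because \<open>\<beta> > 1\<close>. This is uniform integrability of
  \<open>h\<close> over all measures sharing the moment bound \<open>A\<close>.\<close>

lemma (in real_distribution) integral_clip_error:
  assumes A: "(\<integral>\<^sup>+x. \<bar>x\<bar> powr \<beta> \<partial>M) \<le> ennreal A" "A \<ge> 0" and "\<beta> > 1" "K > 0" "L > 0"
    and [measurable]: "h \<in> borel_measurable borel" and h: "\<And>x. \<bar>h x\<bar> \<le> K * (1 + \<bar>x\<bar>)"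
  shows "integrable M h"
    "\<bar>(\<integral>x. h x \<partial>M) - (\<integral>x. clip L (h x) \<partial>M)\<bar> \<le> (2 * K) powr \<beta> * (1 + A) * L powr (1 - \<beta>)"
proof -
  note int = moment_bounded[OF A]
  have clip_meas [measurable]: "clip L \<in> borel_measurable borel"
    unfolding clip_def[abs_def] by measurable
  have le: "\<bar>h x - clip L (h x)\<bar> \<le> (2 * K) powr \<beta> * (1 + \<bar>x\<bar> powr \<beta>) * L powr (1 - \<beta>)" for x
    using clip_error[OF assms(5,3), of "h x"] linear_growth_powr_le[OF h assms(3,4), of x]
    by (smt (verit) mult_right_mono powr_ge_zero)
  have int_clip: "integrable M (\<lambda>x. clip L (h x))"
    using assms(5) by (intro integrable_const_bound[where B = L]) (auto simp: abs_clip_le)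
  have int_diff: "integrable M (\<lambda>x. h x - clip L (h x))"
    by (rule Bochner_Integration.integrable_bound
        [where f = "\<lambda>x. (2 * K) powr \<beta> * (1 + \<bar>x\<bar> powr \<beta>) * L powr (1 - \<beta>)"])
      (use int le in \<open>auto intro!: AE_I2 order_trans[OF le]\<close>)
  from Bochner_Integration.integrable_add[OF this int_clip] show int_h: "integrable M h"
    by simp
  have "\<bar>(\<integral>x. h x \<partial>M) - (\<integral>x. clip L (h x) \<partial>M)\<bar> = \<bar>\<integral>x. h x - clip L (h x) \<partial>M\<bar>"
    using int_h int_clip by simp
  also have "\<dots> \<le> (\<integral>x. \<bar>h x - clip L (h x)\<bar> \<partial>M)"
    by (rule integral_abs_bound)
  also have "\<dots> \<le> (\<integral>x. (2 * K) powr \<beta> * (1 + \<bar>x\<bar> powr \<beta>) * L powr (1 - \<beta>) \<partial>M)"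
    using int int_diff le by (intro integral_mono) auto
  also have "\<dots> = (2 * K) powr \<beta> * (1 + (\<integral>x. \<bar>x\<bar> powr \<beta> \<partial>M)) * L powr (1 - \<beta>)"
    using int by (simp add: prob_space[simplified])
  also have "\<dots> \<le> (2 * K) powr \<beta> * (1 + A) * L powr (1 - \<beta>)"
    using int by (intro mult_left_mono mult_right_mono) auto
  finally show "\<bar>(\<integral>x. h x \<partial>M) - (\<integral>x. clip L (h x) \<partial>M)\<bar> \<le> \<dots>" .
qed

lemma norm_iexp_diff_le: "norm (iexp x - iexp y) \<le> \<bar>x - y\<bar>"
proof -
  have "iexp x - iexp y = iexp y * (iexp (x - y) - 1)"
    by (simp add: algebra_simps flip: exp_add)
  then have "norm (iexp x - iexp y) = norm (iexp (x - y) - 1)"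
    by (simp add: norm_mult)
  also have "\<dots> \<le> \<bar>x - y\<bar>"
    using iexp_approx1[of "x - y" 0] by simp
  finally show ?thesis .
qed

text \<open>A first moment bound \<open>1 + A\<close> follows from
  \<open>\<bar>x\<bar> \<le> 1 + \<bar>x\<bar> powr \<beta>\<close>. Since the Lipschitz constant
  depends on \<open>A\<close> only, closeness of characteristic functions needs testing on a dense
  set only.\<close>

lemma (in real_distribution) char_lipschitz:
  assumes A: "(\<integral>\<^sup>+x. \<bar>x\<bar> powr \<beta> \<partial>M) \<le> ennreal A" "A \<ge> 0" and "\<beta> > 1"
  shows "norm (char M t - char M s) \<le> \<bar>t - s\<bar> * (1 + A)"
proof -
  note int = moment_bounded[OF A]
  have le: "norm (iexp (t * x) - iexp (s * x)) \<le> \<bar>t - s\<bar> * (1 + \<bar>x\<bar> powr \<beta>)" for x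
  proof -
    have "\<bar>x\<bar> \<le> 1 + \<bar>x\<bar> powr \<beta>"
    proof (cases "\<bar>x\<bar> \<le> 1")
      case False
      then have "\<bar>x\<bar> powr 1 \<le> \<bar>x\<bar> powr \<beta>"
        using assms(3) by (intro powr_mono) auto
      then show ?thesis using False by simp
    qed (smt (verit) powr_ge_zero)
    have "norm (iexp (t * x) - iexp (s * x)) \<le> \<bar>t - s\<bar> * \<bar>x\<bar>"
      using norm_iexp_diff_le[of "t * x" "s * x"] by (simp flip: left_diff_distrib abs_mult)
    also have "\<dots> \<le> \<bar>t - s\<bar> * (1 + \<bar>x\<bar> powr \<beta>)"
      by (intro mult_left_mono) (fact, simp)
    finally show ?thesis .
  qed
  have i: "integrable M (\<lambda>x. iexp (u * x))" for u
    by (rule integrable_iexp) auto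
  have "norm (char M t - char M s) = norm (\<integral>x. iexp (t * x) - iexp (s * x) \<partial>M)"
    unfolding char_def by (subst Bochner_Integration.integral_diff[OF i i]) simp
  also have "\<dots> \<le> (\<integral>x. \<bar>t - s\<bar> * (1 + \<bar>x\<bar> powr \<beta>) \<partial>M)"
    using int(1)
    by (intro order_trans[OF integral_norm_bound] integral_mono le integrable_norm
        Bochner_Integration.integrable_diff i Bochner_Integration.integrable_add
        integrable_mult_right integrable_const)
  also have "\<dots> = \<bar>t - s\<bar> * (1 + (\<integral>x. \<bar>x\<bar> powr \<beta> \<partial>M))"
    using int by (simp add: prob_space[simplified])
  also have "\<dots> \<le> \<bar>t - s\<bar> * (1 + A)"
    using int by (intro mult_left_mono) auto
  finally show ?thesis .
qed

text \<open>Weak convergence tests bounded continuous functions; the common moment bound extends it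
  to linear growth. A third of \<epsilon> each pays for clipping under \<open>G n\<close>, for
  clipping under \<open>F\<close>, and for the clipped integrals.\<close>

lemma weak_conv_imp_integral_linear_growth_conv:
  assumes G: "\<And>n. real_distribution (G n)" and F: "real_distribution F" and weak: "weak_conv_m G F"
    and GA: "\<And>n. (\<integral>\<^sup>+x. \<bar>x\<bar> powr \<beta> \<partial>G n) \<le> ennreal A"
    and FA: "(\<integral>\<^sup>+x. \<bar>x\<bar> powr \<beta> \<partial>F) \<le> ennreal A"
    and "A \<ge> 0" "\<beta> > 1" "K > 0"
    and h: "continuous_on UNIV h" "\<And>x. \<bar>h x\<bar> \<le> K * (1 + \<bar>x\<bar>)"
  shows "(\<lambda>n. \<integral>x. h x \<partial>G n) \<longlonglongrightarrow> (\<integral>x. h x \<partial>F)"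
proof (rule LIMSEQ_I)
  fix \<epsilon> :: real assume "\<epsilon> > 0"
  have h_meas: "h \<in> borel_measurable borel"
    using h(1) by (rule borel_measurable_continuous_onI)
  have "((\<lambda>L. (2 * K) powr \<beta> * (1 + A) * L powr (1 - \<beta>)) \<longlongrightarrow> (2 * K) powr \<beta> * (1 + A) * 0) at_top"
    using assms(7) by (intro tendsto_intros tendsto_neg_powr filterlim_ident) simp
  then have "\<forall>\<^sub>F L in at_top. (2 * K) powr \<beta> * (1 + A) * L powr (1 - \<beta>) < \<epsilon> / 3"
    using \<open>\<epsilon> > 0\<close> by (intro order_tendstoD(2)) auto
  then obtain L where L: "L > 0" "(2 * K) powr \<beta> * (1 + A) * L powr (1 - \<beta>) < \<epsilon> / 3"
    using eventually_happens[OF eventually_conj[OF _ eventually_gt_at_top[of 0]]]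
    by (metis (mono_tags, lifting) trivial_limit_at_top_linorder)
  have "(\<lambda>n. \<integral>x. clip L (h x) \<partial>G n) \<longlonglongrightarrow> (\<integral>x. clip L (h x) \<partial>F)"
  proof (rule weak_conv_imp_integral_bdd_continuous_conv[OF G F weak, where B = L])
    show "isCont (\<lambda>x. clip L (h x)) x" for x
      unfolding clip_def using h(1)
      by (intro continuous_intros) (simp add: continuous_on_eq_continuous_at)
    show "norm (clip L (h x)) \<le> L" for x
      using L by (simp add: abs_clip_le)
  qed
  then obtain n0 where n0:
    "\<And>n. n \<ge> n0 \<Longrightarrow> \<bar>(\<integral>x. clip L (h x) \<partial>G n) - (\<integral>x. clip L (h x) \<partial>F)\<bar> < \<epsilon> / 3"
    using LIMSEQ_D[of _ _ "\<epsilon> / 3"] \<open>\<epsilon> > 0\<close> by fastforce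
  have "\<bar>(\<integral>x. h x \<partial>G n) - (\<integral>x. h x \<partial>F)\<bar> < \<epsilon>" if "n \<ge> n0" for n
    using real_distribution.integral_clip_error(2)[OF G GA[of n] assms(6-8) L(1) h_meas h(2)]
      real_distribution.integral_clip_error(2)[OF F FA assms(6-8) L(1) h_meas h(2)]
      n0[OF that] L(2) by linarith
  then show "\<exists>n0. \<forall>n\<ge>n0. norm ((\<integral>x. h x \<partial>G n) - (\<integral>x. h x \<partial>F)) < \<epsilon>"
    by auto
qed

text \<open>A form of the continuity theorem that can be applied to each realisation of a random measure.\<close>

lemma integral_close_if_char_close:
  assumes F: "real_distribution F" and FA: "(\<integral>\<^sup>+x. \<bar>x\<bar> powr \<beta> \<partial>F) \<le> ennreal A"
    and "A \<ge> 0" "\<beta> > 1" "K > 0"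
    and h: "continuous_on UNIV h" "\<And>x. \<bar>h x\<bar> \<le> K * (1 + \<bar>x\<bar>)" and "\<epsilon> > 0"
  obtains T \<delta> where "finite T" "\<delta> > 0"
    "\<And>G. real_distribution G \<Longrightarrow> (\<integral>\<^sup>+x. \<bar>x\<bar> powr \<beta> \<partial>G) \<le> ennreal A \<Longrightarrow>
      (\<And>t. t \<in> T \<Longrightarrow> norm (char G t - char F t) \<le> \<delta>) \<Longrightarrow>
      \<bar>(\<integral>x. h x \<partial>G) - (\<integral>x. h x \<partial>F)\<bar> \<le> \<epsilon>"
proof (rule ccontr)
  assume neg: "\<not> thesis"
  \<comment> \<open>If the claim fails, it fails for the first \<open>n + 1\<close> rationals with
    tolerance \<open>1 / Suc n\<close>, for every \<open>n\<close>. The resulting counterexamples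
    \<open>G n\<close> have characteristic functions converging at every rational.\<close>
  define q :: "nat \<Rightarrow> real" where "q = from_nat_into \<rat>"
  have q: "range q = \<rat>"
    unfolding q_def by (rule range_from_nat_into) (auto intro: countable_rat)
  have "\<forall>n. \<exists>G. real_distribution G \<and> (\<integral>\<^sup>+x. \<bar>x\<bar> powr \<beta> \<partial>G) \<le> ennreal A \<and>
      (\<forall>t\<in>q ` {..n}. norm (char G t - char F t) \<le> 1 / Suc n) \<and>
      \<bar>(\<integral>x. h x \<partial>G) - (\<integral>x. h x \<partial>F)\<bar> > \<epsilon>"
    (is "\<forall>n. \<exists>G. ?P n G")
  proof (rule allI, rule ccontr)
    fix n assume *: "\<nexists>G. ?P n G"
    have thesis
      by (rule that[of "q ` {..n}" "1 / Suc n"]) (use * in \<open>auto simp: not_less\<close>)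
    with neg show False by contradiction
  qed
  from choice[OF this] obtain G where "\<And>n. ?P n (G n)"
    by blast
  then have G: "\<And>n. real_distribution (G n)"
    and GA: "\<And>n. (\<integral>\<^sup>+x. \<bar>x\<bar> powr \<beta> \<partial>G n) \<le> ennreal A"
    and Gq: "\<And>n i. i \<le> n \<Longrightarrow> norm (char (G n) (q i) - char F (q i)) \<le> 1 / Suc n"
    and far: "\<And>n. \<bar>(\<integral>x. h x \<partial>G n) - (\<integral>x. h x \<partial>F)\<bar> > \<epsilon>"
    by (auto simp: Ball_def)
  have "(\<lambda>n. char (G n) t) \<longlonglongrightarrow> char F t" for t
  proof (rule LIMSEQ_I)
    fix e :: real assume "e > 0"
    \<comment> \<open>With this radius, moving from \<open>t\<close> to a rational within distance
      \<open>d\<close> costs less than \<open>e / 3\<close> in the characteristic function of every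
      \<open>G n\<close> and of \<open>F\<close>.\<close>
    define d where "d = e / (3 * (1 + A))"
    have "d > 0" using \<open>e > 0\<close> assms(3) by (simp add: d_def)
    obtain s where "s \<in> \<rat>" "t < s" "s < t + d"
      using Rats_dense_in_real[of t "t + d"] \<open>d > 0\<close> by auto
    moreover from \<open>s \<in> \<rat>\<close> obtain i where "s = q i"
      unfolding q[symmetric] by blast
    ultimately have i: "\<bar>t - q i\<bar> < d"
      by simp
    have lip: "\<bar>t - q i\<bar> * (1 + A) < e / 3"
      using i assms(3) by (simp add: d_def field_simps)
    obtain n1 where n1: "1 / Suc n1 < e / 3"
      using \<open>e > 0\<close> reals_Archimedean[of "e / 3"] by (auto simp: inverse_eq_divide)
    have "norm (char (G n) t - char F t) < e" if "n \<ge> max i n1" for n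
    proof -
      have "1 / real (Suc n) \<le> 1 / Suc n1"
        using that by (intro divide_left_mono) auto
      then have "norm (char (G n) (q i) - char F (q i)) < e / 3"
        using Gq[of i n] n1 that by linarith
      moreover have "norm (char (G n) t - char (G n) (q i)) < e / 3"
        using real_distribution.char_lipschitz[OF G GA assms(3,4), of n t "q i"] lip by linarith
      moreover have "norm (char F t - char F (q i)) < e / 3"
        using real_distribution.char_lipschitz[OF F FA assms(3,4), of t "q i"] lip by linarith
      moreover have "norm (char (G n) t - char F t) \<le> norm (char (G n) t - char (G n) (q i))
          + norm (char (G n) (q i) - char F (q i)) + norm (char F t - char F (q i))"
        using norm_triangle_ineq4[of "(char (G n) t - char (G n) (q i)) + (char (G n) (q i) - char F (q i))"
            "char F t - char F (q i)"]
          norm_triangle_ineq[of "char (G n) t - char (G n) (q i)" "char (G n) (q i) - char F (q i)"]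
        by simp
      ultimately show ?thesis
        by linarith
    qed
    then show "\<exists>n0. \<forall>n\<ge>n0. norm (char (G n) t - char F t) < e" by blast
  qed
  then have "weak_conv_m G F"
    by (intro levy_continuity G F)
  then have "(\<lambda>n. \<integral>x. h x \<partial>G n) \<longlonglongrightarrow> (\<integral>x. h x \<partial>F)"
    by (intro weak_conv_imp_integral_linear_growth_conv[OF G F _ GA FA assms(3-5) h])
  then obtain n where "\<bar>(\<integral>x. h x \<partial>G n) - (\<integral>x. h x \<partial>F)\<bar> < \<epsilon>"
    using LIMSEQ_D[OF _ \<open>\<epsilon> > 0\<close>] by fastforce
  with far[of n] show False by simp
qed

section \<open>Averages of independent variables\<close>

text \<open>Centred terms are bounded by 2 and pairwise orthogonal, so the mean square of the
  deviation is at most \<open>4 / m\<close>. Passing to the first moment costs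
  \<open>1 / (2 * s) + 2 / s\<close> with \<open>s = sqrt m\<close>, which is rounded up to
  \<open>3 / s\<close>. The bound involves nothing about the laws of the \<open>Z i\<close>, hence
  it holds uniformly when the old pool is a frozen parameter.\<close>

lemma (in prob_space) expectation_dist_average_le:
  fixes Z :: "nat \<Rightarrow> 'a \<Rightarrow> complex"
  assumes indep: "indep_vars (\<lambda>_. borel) Z {1..m}" and "m \<ge> 1"
    and bound: "\<And>i \<omega>. norm (Z i \<omega>) \<le> 1"
    and mean: "\<And>i. i \<in> {1..m} \<Longrightarrow> expectation (Z i) = z"
  shows "expectation (\<lambda>\<omega>. norm ((\<Sum>i = 1..m. Z i \<omega>) / of_nat m - z)) \<le> 3 / sqrt m"
proof -
  have meas: "Z i \<in> borel_measurable M" if "i \<in> {1..m}" for i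
    using indep that by (auto simp: indep_vars_def)
  have int: "integrable M (Z i)" if "i \<in> {1..m}" for i
    using meas[OF that] bound by (intro integrable_const_bound[where B = 1]) auto
  have z: "norm z \<le> 1"
  proof -
    have "norm (expectation (Z 1)) \<le> expectation (\<lambda>\<omega>. norm (Z 1 \<omega>))"
      by (rule integral_norm_bound)
    also have "\<dots> \<le> 1"
      using \<open>m \<ge> 1\<close> bound by (intro integral_le_const integrable_norm int) auto
    finally show ?thesis
      using mean[of 1] \<open>m \<ge> 1\<close> by simp
  qed
  define D where "D i \<omega> = Z i \<omega> - z" for i \<omega>
  have D_bound: "norm (D i \<omega>) \<le> 2" for i \<omega>
    unfolding D_def using norm_triangle_ineq4[of "Z i \<omega>" z] bound[of i \<omega>] z by linarith
  have D_meas [measurable]: "D i \<in> borel_measurable M" if "i \<in> {1..m}" for i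
    unfolding D_def[abs_def] using meas[OF that] by measurable
  have D_int: "integrable M (\<lambda>\<omega>. D i \<omega> * cnj (D j \<omega>))" if "i \<in> {1..m}" "j \<in> {1..m}" for i j
  proof (rule integrable_const_bound[where B = 4])
    show "AE \<omega> in M. norm (D i \<omega> * cnj (D j \<omega>)) \<le> 4"
      using mult_mono[OF D_bound D_bound] by (simp add: norm_mult)
    show "(\<lambda>\<omega>. D i \<omega> * cnj (D j \<omega>)) \<in> borel_measurable M"
      using that D_meas
      by (intro borel_measurable_times
          measurable_compose[OF _ borel_measurable_continuous_onI[OF continuous_on_cnj]]) auto
  qed
  have D_orth: "expectation (\<lambda>\<omega>. D i \<omega> * cnj (D j \<omega>)) = 0" if "i \<in> {1..m}" "j \<in> {1..m}" "i \<noteq> j" for i j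
  proof -
    \<comment> \<open>A single family of functions, plain at index \<open>i\<close> and conjugated
      at \<open>j\<close>, turns the covariance into a product over the index set
      \<open>{i, j}\<close>.\<close>
    define g where "g l w = (if l = i then w - z else cnj (w - z))" for l and w :: complex
    have g_meas: "g l \<in> borel_measurable borel" for l
      unfolding g_def by (cases "l = i") (auto intro!: borel_measurable_continuous_onI continuous_intros)
    have "indep_vars (\<lambda>_. borel) (\<lambda>l \<omega>. g l (Z l \<omega>)) {i, j}"
      by (rule indep_vars_compose2[OF indep_vars_subset[OF indep]]) (use that g_meas in auto)
    moreover have "integrable M (\<lambda>\<omega>. g l (Z l \<omega>))" if "l \<in> {i, j}" for l
      using D_bound[of l] measurable_compose[OF meas g_meas] that \<open>i \<in> {1..m}\<close> \<open>j \<in> {1..m}\<close>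
      by (intro integrable_const_bound[where B = 2])
        (auto simp: g_def D_def simp flip: complex_cnj_diff)
    ultimately have "expectation (\<lambda>\<omega>. \<Prod>l\<in>{i, j}. g l (Z l \<omega>)) = (\<Prod>l\<in>{i, j}. expectation (\<lambda>\<omega>. g l (Z l \<omega>)))"
      by (intro indep_vars_lebesgue_integral) auto
    moreover have "expectation (\<lambda>\<omega>. g i (Z i \<omega>)) = 0"
      using int mean that by (simp add: g_def prob_space)
    ultimately show ?thesis
      using that by (simp add: g_def D_def)
  qed
  define Y where "Y \<omega> = (\<Sum>i = 1..m. Z i \<omega>) / of_nat m - z" for \<omega>
  have Y_eq: "Y \<omega> = (\<Sum>i = 1..m. D i \<omega>) / of_nat m" for \<omega>
    using \<open>m \<ge> 1\<close> by (simp add: Y_def D_def sum_subtractf field_simps)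
  have Y_meas [measurable]: "Y \<in> borel_measurable M"
    unfolding Y_eq[abs_def] by measurable
  have Y_bound: "norm (Y \<omega>) \<le> 2" for \<omega>
  proof -
    have "norm (\<Sum>i = 1..m. D i \<omega>) \<le> (\<Sum>i = 1..m. 2)"
      by (intro sum_norm_le D_bound)
    then show ?thesis
      using \<open>m \<ge> 1\<close> by (simp add: Y_eq norm_divide field_simps)
  qed
  have Y_int: "integrable M (\<lambda>\<omega>. norm (Y \<omega>))"
    using Y_bound by (intro integrable_const_bound[where B = 2]) auto
  have Y2_int: "integrable M (\<lambda>\<omega>. (norm (Y \<omega>))\<^sup>2)"
    using power_mono[OF Y_bound, where n = 2] by (intro integrable_const_bound[where B = 4]) auto
  \<comment> \<open>The squared modulus is written as \<open>Y\<close> times its conjugate, which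
    expands into a double sum whose off-diagonal terms vanish.\<close>
  have "complex_of_real (expectation (\<lambda>\<omega>. (norm (Y \<omega>))\<^sup>2)) = expectation (\<lambda>\<omega>. Y \<omega> * cnj (Y \<omega>))"
    by (simp only: complex_norm_square[symmetric] integral_complex_of_real)
  also have "\<dots> = expectation (\<lambda>\<omega>. (\<Sum>i = 1..m. \<Sum>j = 1..m. D i \<omega> * cnj (D j \<omega>)) / (of_nat m)\<^sup>2)"
    by (simp add: Y_eq sum_product power2_eq_square)
  also have "\<dots> = (\<Sum>i = 1..m. \<Sum>j = 1..m. expectation (\<lambda>\<omega>. D i \<omega> * cnj (D j \<omega>))) / (of_nat m)\<^sup>2"
  proof -
    have "expectation (\<lambda>\<omega>. \<Sum>i = 1..m. \<Sum>j = 1..m. D i \<omega> * cnj (D j \<omega>))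
      = (\<Sum>i = 1..m. expectation (\<lambda>\<omega>. \<Sum>j = 1..m. D i \<omega> * cnj (D j \<omega>)))"
      by (intro Bochner_Integration.integral_sum Bochner_Integration.integrable_sum D_int)
    also have "\<dots> = (\<Sum>i = 1..m. \<Sum>j = 1..m. expectation (\<lambda>\<omega>. D i \<omega> * cnj (D j \<omega>)))"
      by (intro sum.cong refl Bochner_Integration.integral_sum D_int)
    finally show ?thesis
      by simp
  qed
  also have "(\<Sum>i = 1..m. \<Sum>j = 1..m. expectation (\<lambda>\<omega>. D i \<omega> * cnj (D j \<omega>)))
      = (\<Sum>i = 1..m. \<Sum>j = 1..m. if j = i then expectation (\<lambda>\<omega>. D i \<omega> * cnj (D i \<omega>)) else 0)"
    by (intro sum.cong refl) (auto simp: D_orth)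
  also have "\<dots> = (\<Sum>i = 1..m. expectation (\<lambda>\<omega>. D i \<omega> * cnj (D i \<omega>)))"
    by simp
  finally have eq: "complex_of_real (expectation (\<lambda>\<omega>. (norm (Y \<omega>))\<^sup>2))
    = (\<Sum>i = 1..m. expectation (\<lambda>\<omega>. D i \<omega> * cnj (D i \<omega>))) / (of_nat m)\<^sup>2" .
  have D2: "norm (expectation (\<lambda>\<omega>. D i \<omega> * cnj (D i \<omega>))) \<le> 4" if "i \<in> {1..m}" for i
  proof -
    have "norm (expectation (\<lambda>\<omega>. D i \<omega> * cnj (D i \<omega>))) \<le> expectation (\<lambda>\<omega>. norm (D i \<omega> * cnj (D i \<omega>)))"
      by (rule integral_norm_bound)
    also have "\<dots> \<le> 4"
    proof (rule integral_le_const)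
      show "integrable M (\<lambda>\<omega>. norm (D i \<omega> * cnj (D i \<omega>)))"
        using D_int that by (intro integrable_norm) auto
      show "AE \<omega> in M. norm (D i \<omega> * cnj (D i \<omega>)) \<le> 4"
        using mult_mono[OF D_bound D_bound] by (simp add: norm_mult)
    qed
    finally show ?thesis .
  qed
  have "expectation (\<lambda>\<omega>. (norm (Y \<omega>))\<^sup>2) \<le> norm (complex_of_real (expectation (\<lambda>\<omega>. (norm (Y \<omega>))\<^sup>2)))"
    by simp
  also have "\<dots> \<le> (\<Sum>i = 1..m. 4) / (real m)\<^sup>2"
    unfolding eq norm_divide norm_power norm_of_nat
    by (intro divide_right_mono sum_norm_le D2) auto
  finally have Y2: "expectation (\<lambda>\<omega>. (norm (Y \<omega>))\<^sup>2) \<le> 4 / m"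
    using \<open>m \<ge> 1\<close> by (simp add: power2_eq_square)
  define s where "s = sqrt m"
  have s: "s > 0" "s * s = m"
    using \<open>m \<ge> 1\<close> by (auto simp: s_def)
  \<comment> \<open>AM-GM: \<open>2 y \<le> 1 / s + s y\<^sup>2\<close>\<close>
  have "norm (Y \<omega>) \<le> 1 / (2 * s) + s / 2 * (norm (Y \<omega>))\<^sup>2" for \<omega>
  proof -
    have "0 \<le> (s * norm (Y \<omega>) - 1)\<^sup>2 / (2 * s)"
      using s by simp
    then show ?thesis
      using s by (simp add: power2_eq_square field_simps)
  qed
  then have "expectation (\<lambda>\<omega>. norm (Y \<omega>)) \<le> expectation (\<lambda>\<omega>. 1 / (2 * s) + s / 2 * (norm (Y \<omega>))\<^sup>2)"
    using Y_int Y2_int by (intro integral_mono) auto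
  also have "\<dots> = 1 / (2 * s) + s / 2 * expectation (\<lambda>\<omega>. (norm (Y \<omega>))\<^sup>2)"
    using Y2_int by (simp add: prob_space)
  also have "\<dots> \<le> 1 / (2 * s) + s / 2 * (4 / m)"
    using Y2 s by (intro add_left_mono mult_left_mono) auto
  also have "\<dots> \<le> 3 / s"
    using s by (simp add: field_simps flip: s(2))
  finally show ?thesis
    by (simp add: Y_def s_def)
qed

section \<open>Uniform sampling and the recursions attached to the law\<close>

lemma integral_uniform_index:
  fixes g :: "nat \<Rightarrow> complex"
  assumes "has_law P (count_space {1..m}) X (uniform_count_measure {1..m})"
  shows "(\<integral>\<omega>. g (X \<omega>) \<partial>P) = (\<Sum>i = 1..m. g i) / of_nat m"
proof -
  have X: "X \<in> measurable P (count_space {1..m})"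
    and law: "distr P (count_space {1..m}) X = uniform_count_measure {1..m}"
    using assms by (auto simp: has_law_def)
  have "(\<integral>\<omega>. g (X \<omega>) \<partial>P) = (\<integral>i. g i \<partial>uniform_count_measure {1..m})"
    unfolding law[symmetric] by (rule integral_distr[symmetric, OF X]) simp
  also have "\<dots> = (\<Sum>i = 1..m. g i) / of_nat m"
    by (simp add: uniform_count_measure_def lebesgue_integral_point_measure_finite
        sum_divide_distrib scaleR_conv_of_real)
  finally show ?thesis .
qed

lemma nn_integral_uniform_index:
  fixes g :: "nat \<Rightarrow> ennreal"
  assumes "has_law P (count_space {1..m}) X (uniform_count_measure {1..m})"
  shows "(\<integral>\<^sup>+\<omega>. g (X \<omega>) \<partial>P) = (\<Sum>i = 1..m. ennreal (1 / m) * g i)"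
proof -
  have X: "X \<in> measurable P (count_space {1..m})"
    and law: "distr P (count_space {1..m}) X = uniform_count_measure {1..m}"
    using assms by (auto simp: has_law_def)
  have "(\<integral>\<^sup>+\<omega>. g (X \<omega>) \<partial>P) = (\<integral>\<^sup>+i. g i \<partial>uniform_count_measure {1..m})"
    unfolding law[symmetric] by (rule nn_integral_distr[symmetric, OF X]) simp
  also have "\<dots> = (\<Sum>i = 1..m. ennreal (1 / m) * g i)"
    by (simp add: uniform_count_measure_def nn_integral_point_measure_finite)
  finally show ?thesis .
qed

lemma has_law_integral:
  fixes g :: "'b \<Rightarrow> 'c::{banach, second_countable_topology}"
  assumes "has_law P S X \<mu>" "g \<in> borel_measurable S"
  shows "(\<integral>\<omega>. g (X \<omega>) \<partial>P) = (\<integral>v. g v \<partial>\<mu>)"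
  using assms by (auto simp: has_law_def integral_distr)

lemma has_law_nn_integral:
  assumes "has_law P S X \<mu>" "g \<in> borel_measurable S"
  shows "(\<integral>\<^sup>+\<omega>. g (X \<omega>) \<partial>P) = (\<integral>\<^sup>+v. g v \<partial>\<mu>)"
  using assms by (auto simp: has_law_def nn_integral_distr)

text \<open>Built from \<open>\<mu>\<close> alone, without a tree, so that both the tree and the
  pools can be compared with the same function; \<open>tree_process_law\<close> identifies it as the
  characteristic function of \<open>R^(k)\<close>.\<close>

primrec process_char :: "(real \<times> nat \<times> (nat \<Rightarrow> real)) measure \<Rightarrow> nat \<Rightarrow> real \<Rightarrow> complex" where
  "process_char \<mu> 0 = (\<lambda>t. \<integral>v. iexp (t * fst v) \<partial>\<mu>)"
| "process_char \<mu> (Suc k) = (\<lambda>t. \<integral>v. branch_char (process_char \<mu> k) t v \<partial>\<mu>)"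

text \<open>Iterates the one-step estimate \<open>nn_integral_branch_sum_powr\<close>. The same
  sequence serves the tree and the pools; the pool size does not enter it, which is the source of
  uniformity in \<open>m\<close>.\<close>

primrec moment_bound :: "(real \<times> nat \<times> (nat \<Rightarrow> real)) measure \<Rightarrow> real \<Rightarrow> nat \<Rightarrow> ennreal" where
  "moment_bound \<mu> \<beta> 0 = (\<integral>\<^sup>+v. \<bar>fst v\<bar> powr \<beta> \<partial>\<mu>)"
| "moment_bound \<mu> \<beta> (Suc k) = ennreal (2 powr \<beta>) *
     ((\<integral>\<^sup>+v. \<bar>fst v\<bar> powr \<beta> \<partial>\<mu>) + (\<integral>\<^sup>+v. weight_sum v powr \<beta> \<partial>\<mu>) * moment_bound \<mu> \<beta> k)"

lemma moment_bound_finite: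
  assumes "(\<integral>\<^sup>+v. \<bar>fst v\<bar> powr \<beta> \<partial>\<mu>) < \<infinity>" "(\<integral>\<^sup>+v. weight_sum v powr \<beta> \<partial>\<mu>) < \<infinity>"
  shows "moment_bound \<mu> \<beta> k < \<infinity>"
  by (induction k) (use assms in \<open>auto simp: ennreal_mult_less_top\<close>)

section \<open>The branching tree\<close>

text \<open>Generations are defined by appending a last letter, whereas the recursion for the
  process splits the tree at the root. Here nodes are sorted by their first letter instead.\<close>

lemma generation_Suc_shift:
  "generation N (Suc n) \<omega> = (\<Union>r\<in>{1..N [] \<omega>}. (#) r ` generation (\<lambda>i. N (r # i)) n \<omega>)"
proof (induction n)
  case 0
  show ?case by auto
next
  case (Suc n)
  have "generation N (Suc (Suc n)) \<omega>
      = {i @ [j] | i j. i \<in> generation N (Suc n) \<omega> \<and> 1 \<le> j \<and> j \<le> N i \<omega>}"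
    by simp
  also have "\<dots> = (\<Union>r\<in>{1..N [] \<omega>}. (#) r ` generation (\<lambda>i. N (r # i)) (Suc n) \<omega>)"
    unfolding Suc.IH by (fastforce simp: image_iff)
  finally show ?case .
qed

lemma path_weight_Cons:
  "path_weight C (r # i) \<omega> = C [r] \<omega> * path_weight (\<lambda>i. C (r # i)) i \<omega>"
proof (induction i rule: rev_induct)
  case Nil
  show ?case using path_weight.simps(2)[of C "[]" r \<omega>] by simp
next
  case (snoc j i)
  have "path_weight C (r # i @ [j]) \<omega> = C (r # i @ [j]) \<omega> * path_weight C (r # i) \<omega>"
    using path_weight.simps(2)[of C "r # i" j \<omega>] by simp
  then show ?case
    using snoc by simp
qed

lemma finite_generation: "finite (generation N n \<omega>)"
proof (induction n)
  case (Suc n)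
  have "generation N (Suc n) \<omega> = (\<Union>i\<in>generation N n \<omega>. (\<lambda>j. i @ [j]) ` {1..N i \<omega>})"
    by auto
  then show ?case
    using Suc by simp
qed simp

abbreviation node_vector where
  "node_vector Q N C i \<equiv> branching_vector (Q i) (N i) (\<lambda>r. C (i @ [r]))"

text \<open>A pathwise form of the distributional recursion: generation 0 contributes the root's
  \<open>Q\<close>, and each later generation is sorted by the child of the root it descends from.
  Interchanging the sums over generations and children collects the truncated processes of the
  subtrees.\<close>

lemma tree_process_Suc:
  "tree_process Q N C (Suc k) \<omega> = branch_sum (node_vector Q N C [] \<omega>)
     (\<lambda>r. tree_process (\<lambda>i. Q (r # i)) (\<lambda>i. N (r # i)) (\<lambda>i. C (r # i)) k \<omega>)"
proof -
  have "(\<Sum>i\<in>generation N (Suc j) \<omega>. Q i \<omega> * path_weight C i \<omega>)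
      = (\<Sum>r = 1..N [] \<omega>. C [r] \<omega> * (\<Sum>i\<in>generation (\<lambda>i. N (r # i)) j \<omega>.
          Q (r # i) \<omega> * path_weight (\<lambda>i. C (r # i)) i \<omega>))" for j
  proof -
    have "(\<Sum>i\<in>generation N (Suc j) \<omega>. Q i \<omega> * path_weight C i \<omega>)
      = (\<Sum>r = 1..N [] \<omega>. \<Sum>i\<in>(#) r ` generation (\<lambda>i. N (r # i)) j \<omega>. Q i \<omega> * path_weight C i \<omega>)"
      unfolding generation_Suc_shift
      by (rule sum.UNION_disjoint) (auto simp: finite_generation)
    also have "\<dots> = (\<Sum>r = 1..N [] \<omega>. C [r] \<omega> * (\<Sum>i\<in>generation (\<lambda>i. N (r # i)) j \<omega>.
          Q (r # i) \<omega> * path_weight (\<lambda>i. C (r # i)) i \<omega>))"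
      by (intro sum.cong refl) (simp add: sum.reindex path_weight_Cons sum_distrib_left mult_ac)
    finally show ?thesis .
  qed
  note gen = this
  have "tree_process Q N C (Suc k) \<omega> = Q [] \<omega> +
      (\<Sum>j = 0..k. \<Sum>i\<in>generation N (Suc j) \<omega>. Q i \<omega> * path_weight C i \<omega>)"
    unfolding tree_process_def
    by (simp add: sum.atLeast0_atMost_Suc_shift del: generation.simps(2) sum.cl_ivl_Suc)
  also have "(\<Sum>j = 0..k. \<Sum>i\<in>generation N (Suc j) \<omega>. Q i \<omega> * path_weight C i \<omega>)
      = (\<Sum>r = 1..N [] \<omega>. C [r] \<omega> *
          tree_process (\<lambda>i. Q (r # i)) (\<lambda>i. N (r # i)) (\<lambda>i. C (r # i)) k \<omega>)"
    unfolding gen tree_process_def by (subst sum.swap) (simp add: sum_distrib_left)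
  finally show ?thesis
    by (simp add: branch_sum_branching_vector)
qed

lemma tree_process_0: "tree_process Q N C 0 \<omega> = fst (node_vector Q N C [] \<omega>)"
  by (simp add: tree_process_def branching_vector_def)

lemma Cons_in_nodes: "r \<ge> 1 \<Longrightarrow> i \<in> nodes \<Longrightarrow> r # i \<in> nodes"
  and Nil_in_nodes: "[] \<in> nodes"
  by (auto simp: nodes_def)

lemma tree_process_measurable:
  assumes "\<And>i. i \<in> nodes \<Longrightarrow> node_vector Q N C i \<in> measurable M branching_space"
  shows "tree_process Q N C k \<in> borel_measurable M"
  using assms
proof (induction k arbitrary: Q N C)
  case 0
  then show ?case
    unfolding tree_process_0[abs_def]
    by (intro measurable_compose[OF 0 measurable_branching_space_fst] Nil_in_nodes)
next
  case (Suc k)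
  have "tree_process (\<lambda>i. Q (r # i)) (\<lambda>i. N (r # i)) (\<lambda>i. C (r # i)) k \<in> borel_measurable M"
    if "r \<ge> 1" for r
    by (rule Suc.IH) (use Suc.prems[OF Cons_in_nodes[OF that]] in simp)
  then show ?case
    unfolding tree_process_Suc[abs_def]
    by (intro measurable_branch_sum Suc.prems Nil_in_nodes)
qed

lemma has_law_funcset: "has_law P S X \<mu> \<Longrightarrow> X \<in> space P \<rightarrow> space S"
  by (auto simp: has_law_def measurable_def)

lemma independent_sources_vimage:
  assumes "prob_space P" "prob_space.indep_vars P (\<lambda>_. N) X S"
  shows "independent_sources P (\<lambda>i. sets (vimage_algebra (space P) (X i) N)) S"
proof -
  interpret prob_space P by fact
  show ?thesis
  proof (intro independent_sources.intro independent_sources_axioms.intro)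
    show "prob_space P" by fact
    have "indep_sets (\<lambda>i. {X i -` A \<inter> space P | A. A \<in> sets N}) S"
      using assms(2) by (simp add: indep_vars_def2)
    then show "indep_sets (\<lambda>i. sets (vimage_algebra (space P) (X i) N)) S"
    proof (rule indep_sets_mono_sets)
      show "sets (vimage_algebra (space P) (X i) N) \<subseteq> {X i -` A \<inter> space P | A. A \<in> sets N}"
        if "i \<in> S" for i
        using assms(2) that sets_vimage_algebra2[of "X i" "space P" N]
        by (auto simp: indep_vars_def2 measurable_def)
    qed
    show "sigma_algebra (space P) (sets (vimage_algebra (space P) (X s) N))" for s
      using sets.sigma_algebra_axioms[of "vimage_algebra (space P) (X s) N"] by simp
  qed
qed

text \<open>Prefixing with \<open>r\<close> is injective and stays inside \<open>nodes\<close>, so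
  the vectors of the subtree are a subfamily of the i.i.d. family.\<close>

lemma branching_tree_subtree:
  assumes "branching_tree T \<mu> Q N C" "r \<ge> 1"
  shows "branching_tree T \<mu> (\<lambda>i. Q (r # i)) (\<lambda>i. N (r # i)) (\<lambda>i. C (r # i))"
proof -
  let ?X = "node_vector Q N C"
  let ?E = "\<lambda>i. sets (vimage_algebra (space T) (?X i) branching_space)"
  have T: "prob_space T" "\<And>i. i \<in> nodes \<Longrightarrow> has_law T branching_space (?X i) \<mu>"
    "prob_space.indep_vars T (\<lambda>_. branching_space) ?X nodes"
    using assms(1) by (auto simp: branching_tree_def)
  interpret independent_sources T ?E nodes
    by (rule independent_sources_vimage[OF T(1,3)])
  have "indep_vars (\<lambda>_. branching_space) (\<lambda>i. ?X (r # i)) nodes"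
  proof (rule indep_vars_gen[of "\<lambda>i. {r # i}"])
    show "disjoint_family_on (\<lambda>i. {r # i}) nodes"
      by (auto simp: disjoint_family_on_def)
    show "?X (r # i) \<in> measurable (gen {r # i}) branching_space" if "i \<in> nodes" for i
      using has_law_funcset[OF T(2)[OF Cons_in_nodes[OF assms(2) that]]] Cons_in_nodes[OF assms(2) that]
      by (intro measurable_gen_vimage[where s = "r # i"]) auto
  qed
  moreover have "has_law T branching_space (?X (r # i)) \<mu>" if "i \<in> nodes" for i
    by (rule T(2)[OF Cons_in_nodes[OF assms(2) that]])
  ultimately show ?thesis
    using T(1) by (simp add: branching_tree_def)
qed

text \<open>Both claims rest on the same splitting of the sources at the root, hence one induction.
  It ranges over all trees because the hypothesis is applied to the subtrees.\<close>

lemma tree_process_law: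
  assumes "branching_tree T \<mu> Q N C" "\<beta> > 1"
  shows "(\<integral>\<omega>. iexp (t * tree_process Q N C k \<omega>) \<partial>T) = process_char \<mu> k t"
    and "(\<integral>\<^sup>+\<omega>. \<bar>tree_process Q N C k \<omega>\<bar> powr \<beta> \<partial>T) \<le> moment_bound \<mu> \<beta> k"
proof -
  have "(\<forall>t. (\<integral>\<omega>. iexp (t * tree_process Q N C k \<omega>) \<partial>T) = process_char \<mu> k t) \<and>
     (\<integral>\<^sup>+\<omega>. \<bar>tree_process Q N C k \<omega>\<bar> powr \<beta> \<partial>T) \<le> moment_bound \<mu> \<beta> k"
    using assms(1)
  proof (induction k arbitrary: Q N C)
    case 0
    have law: "has_law T branching_space (node_vector Q N C []) \<mu>"
      using 0 Nil_in_nodes by (auto simp: branching_tree_def)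
    have "(\<integral>\<omega>. iexp (t * fst (node_vector Q N C [] \<omega>)) \<partial>T) = (\<integral>v. iexp (t * fst v) \<partial>\<mu>)" for t
      by (rule has_law_integral[OF law]) measurable
    moreover have "(\<integral>\<^sup>+\<omega>. \<bar>fst (node_vector Q N C [] \<omega>)\<bar> powr \<beta> \<partial>T) = (\<integral>\<^sup>+v. \<bar>fst v\<bar> powr \<beta> \<partial>\<mu>)"
      by (rule has_law_nn_integral[OF law]) measurable
    ultimately show ?case
      by (simp add: tree_process_0 del: of_real_mult)
  next
    case (Suc k)
    let ?X = "node_vector Q N C"
    let ?E = "\<lambda>i. sets (vimage_algebra (space T) (?X i) branching_space)"
    let ?R = "\<lambda>r. tree_process (\<lambda>i. Q (r # i)) (\<lambda>i. N (r # i)) (\<lambda>i. C (r # i)) k"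
    \<comment> \<open>Block 0 is the root; block \<open>r\<close> consists of the nodes of the
      subtree below child \<open>r\<close>.\<close>
    define A :: "nat \<Rightarrow> nat list set" where "A r = (if r = 0 then {[]} else (#) r ` nodes)" for r
    have T: "prob_space T" "\<And>i. i \<in> nodes \<Longrightarrow> has_law T branching_space (?X i) \<mu>"
      "prob_space.indep_vars T (\<lambda>_. branching_space) ?X nodes"
      using Suc.prems by (auto simp: branching_tree_def)
    interpret independent_sources T ?E nodes
      by (rule independent_sources_vimage[OF T(1,3)])
    have X: "?X i \<in> measurable (gen D) branching_space" if "i \<in> D" "i \<in> nodes" for i D
      using has_law_funcset[OF T(2)] that by (intro measurable_gen_vimage[where s = i]) auto
    have A: "disjoint_family A"
      by (auto simp: disjoint_family_on_def A_def)
    have X0: "?X [] \<in> measurable (gen (A 0)) branching_space"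
      by (intro X) (auto simp: A_def Nil_in_nodes)
    have R: "?R r \<in> borel_measurable (gen (A r))" if "r \<ge> 1" for r
    proof (rule tree_process_measurable)
      show "node_vector (\<lambda>i. Q (r # i)) (\<lambda>i. N (r # i)) (\<lambda>i. C (r # i)) i
          \<in> measurable (gen (A r)) branching_space" if "i \<in> nodes" for i
        using X[of "r # i" "A r"] Cons_in_nodes[OF \<open>r \<ge> 1\<close> that] \<open>r \<ge> 1\<close> that by (simp add: A_def)
    qed
    note IH = Suc.IH[OF branching_tree_subtree[OF Suc.prems]]
    have law: "has_law T branching_space (?X []) \<mu>"
      by (intro T(2) Nil_in_nodes)
    \<comment> \<open>Child 1 serves as a concrete variable with this characteristic function. Its
      only purpose is measurability of \<open>process_char \<mu> k\<close>.\<close>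
    have phi_eq: "process_char \<mu> k = char (distr T borel (?R 1))"
      using IH[of 1] measurable_gen_imp[OF R[of 1]]
      by (auto simp: char_def integral_distr fun_eq_iff)
    interpret D: real_distribution "distr T borel (?R 1)"
      by (rule real_distribution_distr) (use measurable_gen_imp[OF R[of 1]] in simp)
    have phi_meas: "(\<lambda>v. branch_char (process_char \<mu> k) t v) \<in> borel_measurable branching_space" for t
      unfolding phi_eq
      by (rule measurable_branch_char[where V = "\<lambda>v. v"])
        (simp, rule measurable_compose[OF _ D.char_measurable])
    have "(\<integral>\<omega>. iexp (t * tree_process Q N C (Suc k) \<omega>) \<partial>T) = process_char \<mu> (Suc k) t" for t
    proof -
      have "(\<integral>\<omega>. iexp (t * tree_process Q N C (Suc k) \<omega>) \<partial>T)
          = (\<integral>\<omega>. branch_char (process_char \<mu> k) t (?X [] \<omega>) \<partial>T)"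
        unfolding tree_process_Suc
        by (rule integral_iexp_branch_sum[OF A X0 R]) (use IH in auto)
      also have "\<dots> = process_char \<mu> (Suc k) t"
        unfolding process_char.simps by (rule has_law_integral[OF law phi_meas])
      finally show ?thesis .
    qed
    moreover have "(\<integral>\<^sup>+\<omega>. \<bar>tree_process Q N C (Suc k) \<omega>\<bar> powr \<beta> \<partial>T) \<le> moment_bound \<mu> \<beta> (Suc k)"
    proof -
      have "(\<integral>\<^sup>+\<omega>. \<bar>tree_process Q N C (Suc k) \<omega>\<bar> powr \<beta> \<partial>T) \<le> ennreal (2 powr \<beta>) *
          ((\<integral>\<^sup>+\<omega>. \<bar>fst (?X [] \<omega>)\<bar> powr \<beta> \<partial>T) + (\<integral>\<^sup>+\<omega>. weight_sum (?X [] \<omega>) powr \<beta> \<partial>T) * moment_bound \<mu> \<beta> k)"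
        unfolding tree_process_Suc
        by (rule nn_integral_branch_sum_powr[OF A X0 R assms(2)]) (use IH in auto)
      also have "(\<integral>\<^sup>+\<omega>. \<bar>fst (?X [] \<omega>)\<bar> powr \<beta> \<partial>T) = (\<integral>\<^sup>+v. \<bar>fst v\<bar> powr \<beta> \<partial>\<mu>)"
        by (rule has_law_nn_integral[OF law]) measurable
      also have "(\<integral>\<^sup>+\<omega>. weight_sum (?X [] \<omega>) powr \<beta> \<partial>T) = (\<integral>\<^sup>+v. weight_sum v powr \<beta> \<partial>\<mu>)"
        by (rule has_law_nn_integral[OF law]) measurable
      finally show ?thesis by simp
    qed
    ultimately show ?case by blast
  qed
  then show "(\<integral>\<omega>. iexp (t * tree_process Q N C k \<omega>) \<partial>T) = process_char \<mu> k t"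
    and "(\<integral>\<^sup>+\<omega>. \<bar>tree_process Q N C k \<omega>\<bar> powr \<beta> \<partial>T) \<le> moment_bound \<mu> \<beta> k"
    by blast+
qed

section \<open>The bootstrap pools\<close>

primrec source_level :: "source \<Rightarrow> nat" where
  "source_level (Initial i) = 0"
| "source_level (Vector j i) = j"
| "source_level (Index j i r) = j"

definition past :: "nat \<Rightarrow> source set" where
  "past k = {s. source_level s \<le> k}"

text \<open>All inputs used by entry \<open>i\<close> of level \<open>j\<close>. The label
  \<open>Index j i 0\<close> is included too, but it lies outside \<open>sources m\<close> and so
  adds nothing to \<open>gen\<close>.\<close>

definition fresh :: "nat \<Rightarrow> nat \<Rightarrow> source set" where
  "fresh j i = insert (Vector j i) (range (Index j i))"

locale bootstrap =
  fixes B :: "'c measure" and \<mu> :: "(real \<times> nat \<times> (nat \<Rightarrow> real)) measure" and m :: nat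
    and Q :: "nat \<Rightarrow> nat \<Rightarrow> 'c \<Rightarrow> real" and N :: "nat \<Rightarrow> nat \<Rightarrow> 'c \<Rightarrow> nat"
    and C :: "nat \<Rightarrow> nat \<Rightarrow> nat \<Rightarrow> 'c \<Rightarrow> real" and J :: "nat \<Rightarrow> nat \<Rightarrow> nat \<Rightarrow> 'c \<Rightarrow> nat"
  assumes inputs: "bootstrap_inputs B \<mu> m Q N C J" and m_pos: "m \<ge> 1"
begin

abbreviation vec :: "nat \<Rightarrow> nat \<Rightarrow> 'c \<Rightarrow> real \<times> nat \<times> (nat \<Rightarrow> real)" where
  "vec j i \<equiv> branching_vector (Q j i) (N j i) (C j i)"

abbreviation R :: "nat \<Rightarrow> nat \<Rightarrow> 'c \<Rightarrow> real" where
  "R \<equiv> pool Q N C J"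

lemma initial_law: "i \<in> {1..m} \<Longrightarrow> has_law B borel (Q 0 i) (distr \<mu> borel fst)"
  and vec_law: "j \<ge> 1 \<Longrightarrow> i \<in> {1..m} \<Longrightarrow> has_law B branching_space (vec j i) \<mu>"
  and index_law: "j \<ge> 1 \<Longrightarrow> i \<in> {1..m} \<Longrightarrow> r \<ge> 1 \<Longrightarrow>
    has_law B (count_space {1..m}) (J j i r) (uniform_count_measure {1..m})"
  using inputs by (auto simp: bootstrap_inputs_def)

sublocale independent_sources B "source_events B Q N C J" "sources m"
proof (intro independent_sources.intro independent_sources_axioms.intro)
  show "prob_space B" and "prob_space.indep_sets B (source_events B Q N C J) (sources m)"
    using inputs by (auto simp: bootstrap_inputs_def)
  show "sigma_algebra (space B) (source_events B Q N C J s)" for s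
    by (cases s) (use sets.sigma_algebra_axioms[of "vimage_algebra (space B) _ _"] in auto)
qed

lemma measurable_initial:
  assumes "i \<in> {1..m}" "Initial i \<in> A"
  shows "Q 0 i \<in> borel_measurable (gen A)"
  using assms has_law_funcset[OF initial_law]
  by (intro measurable_gen_vimage[where s = "Initial i"]) (auto simp: sources_def)

lemma measurable_vec:
  assumes "j \<ge> 1" "i \<in> {1..m}" "Vector j i \<in> A"
  shows "vec j i \<in> measurable (gen A) branching_space"
  using assms has_law_funcset[OF vec_law[of j i]]
  by (intro measurable_gen_vimage[where s = "Vector j i"]) (auto simp: sources_def)

lemma measurable_index:
  assumes "j \<ge> 1" "i \<in> {1..m}" "r \<ge> 1" "Index j i r \<in> A"
  shows "J j i r \<in> measurable (gen A) (count_space {1..m})"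
proof -
  \<comment> \<open>The source events refer to \<open>count_space UNIV\<close>; the smaller target
    space comes from the fact that the index lies in \<open>{1..m}\<close> surely.\<close>
  have "J j i r \<in> measurable (gen A) (count_space UNIV)"
    using assms by (intro measurable_gen_vimage[where s = "Index j i r"]) (auto simp: sources_def)
  then show ?thesis
    using has_law_funcset[OF index_law[OF assms(1-3)]] by (auto simp: measurable_def)
qed

lemma pool_Suc: "R (Suc k) i \<omega> = branch_sum (vec (Suc k) i \<omega>) (\<lambda>r. R k (J (Suc k) i r \<omega>) \<omega>)"
  by (simp add: branch_sum_branching_vector)

lemma measurable_pool: "i \<in> {1..m} \<Longrightarrow> R k i \<in> borel_measurable (gen (past k))"
proof (induction k arbitrary: i)
  case 0
  show ?case
    using measurable_initial[OF 0, of "past 0"] by (simp add: past_def fun_eq_iff[symmetric])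
next
  case (Suc k)
  have "(\<lambda>\<omega>. R k (J (Suc k) i r \<omega>) \<omega>) \<in> borel_measurable (gen (past (Suc k)))" if "r \<ge> 1" for r
  proof (rule measurable_compose_countable'[where I = "{1..m}"])
    show "R k l \<in> borel_measurable (gen (past (Suc k)))" if "l \<in> {1..m}" for l
      by (rule measurable_gen_mono[OF _ Suc.IH[OF that]]) (auto simp: past_def)
    show "J (Suc k) i r \<in> measurable (gen (past (Suc k))) (count_space {1..m})"
      using Suc.prems that by (intro measurable_index) (auto simp: past_def)
  qed simp
  then show ?case
    unfolding pool_Suc[abs_def]
    using Suc.prems by (intro measurable_branch_sum measurable_vec) (auto simp: past_def)
qed

text \<open>The old pool is read at the first argument and the new inputs at the second, as
  decoupling requires. \<open>A\<close> is kept general: moments use the inputs of one entry,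
  averages those of all entries.\<close>

lemma measurable_decoupled_pool:
  assumes "i \<in> {1..m}" "fresh (Suc k) i \<subseteq> A"
  shows "(\<lambda>p. branch_sum (vec (Suc k) i (snd p)) (\<lambda>r. R k (J (Suc k) i r (snd p)) (fst p)))
    \<in> borel_measurable (gen (past k) \<Otimes>\<^sub>M gen A)"
proof (rule measurable_branch_sum[where V = "\<lambda>p. vec (Suc k) i (snd p)"
      and Y = "\<lambda>r p. R k (J (Suc k) i r (snd p)) (fst p)"])
  show "(\<lambda>p. vec (Suc k) i (snd p)) \<in> measurable (gen (past k) \<Otimes>\<^sub>M gen A) branching_space"
    using assms by (intro measurable_compose[OF measurable_snd measurable_vec]) (auto simp: fresh_def)
  show "(\<lambda>p. R k (J (Suc k) i r (snd p)) (fst p)) \<in> borel_measurable (gen (past k) \<Otimes>\<^sub>M gen A)"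
    if "r \<ge> 1" for r
  proof (rule measurable_compose_countable'[where I = "{1..m}"])
    show "(\<lambda>p. R k l (fst p)) \<in> borel_measurable (gen (past k) \<Otimes>\<^sub>M gen A)" if "l \<in> {1..m}" for l
      by (rule measurable_compose[OF measurable_fst measurable_pool[OF that]])
    show "(\<lambda>p. J (Suc k) i r (snd p)) \<in> measurable (gen (past k) \<Otimes>\<^sub>M gen A) (count_space {1..m})"
      using assms that
      by (intro measurable_compose[OF measurable_snd measurable_index]) (auto simp: fresh_def)
  qed simp
qed

lemma past_fresh_disjoint: "past k \<inter> (\<Union>i\<in>I. fresh (Suc k) i) = {}"
  by (auto simp: past_def fresh_def)

text \<open>Splits the inputs of one entry into the block family expected by the lemmas on branching
  sums: the vector in block 0, the \<open>r\<close>-th index in block \<open>r\<close>. With the old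
  pool frozen, the \<open>r\<close>-th summand's input depends on that index only.\<close>

definition row_sources :: "nat \<Rightarrow> nat \<Rightarrow> nat \<Rightarrow> source set" where
  "row_sources j i r = (if r = 0 then {Vector j i} else {Index j i r})"

lemma disjoint_row_sources: "disjoint_family (row_sources j i)"
  by (auto simp: disjoint_family_on_def row_sources_def)

lemma measurable_row:
  assumes "i \<in> {1..m}"
  shows "vec (Suc k) i \<in> measurable (gen (row_sources (Suc k) i 0)) branching_space"
    and "r \<ge> 1 \<Longrightarrow> (\<lambda>\<omega>'. R k (J (Suc k) i r \<omega>') \<omega>) \<in> borel_measurable (gen (row_sources (Suc k) i r))"
proof -
  show "vec (Suc k) i \<in> measurable (gen (row_sources (Suc k) i 0)) branching_space"
    using assms by (intro measurable_vec) (auto simp: row_sources_def)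
  show "(\<lambda>\<omega>'. R k (J (Suc k) i r \<omega>') \<omega>) \<in> borel_measurable (gen (row_sources (Suc k) i r))" if "r \<ge> 1"
    using assms that
    by (intro measurable_compose[OF measurable_index[of "Suc k" i r], of _ "\<lambda>l. R k l \<omega>"])
      (auto simp: row_sources_def)
qed

text \<open>Given the old pool, a sampled value has as its moment the average over that pool. Taking
  expectations, an average of \<open>m\<close> terms each at most
  \<open>moment_bound \<mu> \<beta> k\<close> is again at most this bound, so \<open>m\<close>
  cancels.\<close>

lemma pool_moment:
  assumes "\<beta> > 1" "i \<in> {1..m}"
  shows "(\<integral>\<^sup>+\<omega>. \<bar>R k i \<omega>\<bar> powr \<beta> \<partial>B) \<le> moment_bound \<mu> \<beta> k"
  using assms(2)
proof (induction k arbitrary: i)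
  case 0
  have fst_meas: "fst \<in> borel_measurable \<mu>"
    using vec_law[of 1 1] m_pos by (auto simp: has_law_def)
  have "(\<integral>\<^sup>+\<omega>. \<bar>R 0 i \<omega>\<bar> powr \<beta> \<partial>B) = (\<integral>\<^sup>+q. \<bar>q\<bar> powr \<beta> \<partial>distr \<mu> borel fst)"
    unfolding pool.simps by (rule has_law_nn_integral[OF initial_law[OF 0]]) measurable
  also have "\<dots> = moment_bound \<mu> \<beta> 0"
    by (simp add: nn_integral_distr[OF fst_meas])
  finally show ?case by simp
next
  case (Suc k)
  let ?b = "moment_bound \<mu> \<beta> k"
  let ?S = "\<lambda>\<omega> \<omega>'. branch_sum (vec (Suc k) i \<omega>') (\<lambda>r. R k (J (Suc k) i r \<omega>') \<omega>)"
  let ?q = "\<integral>\<^sup>+v. \<bar>fst v\<bar> powr \<beta> \<partial>\<mu>" and ?w = "\<integral>\<^sup>+v. weight_sum v powr \<beta> \<partial>\<mu>"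
  note law = vec_law[of "Suc k" i, simplified, OF Suc.prems[simplified]]
  have m: "(\<lambda>p. ennreal (\<bar>?S (fst p) (snd p)\<bar> powr \<beta>))
      \<in> borel_measurable (gen (past k) \<Otimes>\<^sub>M gen (fresh (Suc k) i))"
    using measurable_decoupled_pool[OF Suc.prems order_refl] by measurable
  have "(\<integral>\<^sup>+\<omega>. \<bar>R (Suc k) i \<omega>\<bar> powr \<beta> \<partial>B) = (\<integral>\<^sup>+\<omega>. \<integral>\<^sup>+\<omega>'. \<bar>?S \<omega> \<omega>'\<bar> powr \<beta> \<partial>B \<partial>B)"
    unfolding pool_Suc
    using decouple_nn_integral[OF past_fresh_disjoint[of k "{i}"], of "\<lambda>p. ennreal (\<bar>?S (fst p) (snd p)\<bar> powr \<beta>)"] m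
    by simp
  also have "\<dots> \<le> (\<integral>\<^sup>+\<omega>. ennreal (2 powr \<beta>) * (?q + ?w * (\<Sum>l = 1..m. ennreal (1 / m) * ennreal (\<bar>R k l \<omega>\<bar> powr \<beta>))) \<partial>B)"
  proof (rule nn_integral_mono)
    fix \<omega>
    have "(\<integral>\<^sup>+\<omega>'. \<bar>?S \<omega> \<omega>'\<bar> powr \<beta> \<partial>B) \<le> ennreal (2 powr \<beta>) *
      ((\<integral>\<^sup>+\<omega>'. \<bar>fst (vec (Suc k) i \<omega>')\<bar> powr \<beta> \<partial>B) + (\<integral>\<^sup>+\<omega>'. weight_sum (vec (Suc k) i \<omega>') powr \<beta> \<partial>B) *
        (\<Sum>l = 1..m. ennreal (1 / m) * ennreal (\<bar>R k l \<omega>\<bar> powr \<beta>)))"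
    proof (rule nn_integral_branch_sum_powr[OF disjoint_row_sources measurable_row[OF Suc.prems] assms(1)])
      show "(\<integral>\<^sup>+\<omega>'. \<bar>R k (J (Suc k) i r \<omega>') \<omega>\<bar> powr \<beta> \<partial>B)
          \<le> (\<Sum>l = 1..m. ennreal (1 / m) * ennreal (\<bar>R k l \<omega>\<bar> powr \<beta>))" if "r \<ge> 1" for r
        using nn_integral_uniform_index[OF index_law[OF _ Suc.prems that], of "Suc k" "\<lambda>l. ennreal (\<bar>R k l \<omega>\<bar> powr \<beta>)"]
        by simp
    qed
    also have "(\<integral>\<^sup>+\<omega>'. \<bar>fst (vec (Suc k) i \<omega>')\<bar> powr \<beta> \<partial>B) = ?q"
      by (rule has_law_nn_integral[OF law]) measurable
    also have "(\<integral>\<^sup>+\<omega>'. weight_sum (vec (Suc k) i \<omega>') powr \<beta> \<partial>B) = ?w"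
      by (rule has_law_nn_integral[OF law]) measurable
    finally show "(\<integral>\<^sup>+\<omega>'. \<bar>?S \<omega> \<omega>'\<bar> powr \<beta> \<partial>B) \<le> ennreal (2 powr \<beta>) *
      (?q + ?w * (\<Sum>l = 1..m. ennreal (1 / m) * ennreal (\<bar>R k l \<omega>\<bar> powr \<beta>)))" .
  qed
  also have "\<dots> = ennreal (2 powr \<beta>) *
      (?q + ?w * (\<Sum>l = 1..m. ennreal (1 / m) * (\<integral>\<^sup>+\<omega>. \<bar>R k l \<omega>\<bar> powr \<beta> \<partial>B)))"
  proof -
    have mR: "(\<lambda>\<omega>. ennreal (\<bar>R k l \<omega>\<bar> powr \<beta>)) \<in> borel_measurable B" if "l \<in> {1..m}" for l
      using measurable_gen_imp[OF measurable_pool[OF that]] by measurable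
    have mS: "(\<lambda>\<omega>. \<Sum>l = 1..m. ennreal (1 / m) * ennreal (\<bar>R k l \<omega>\<bar> powr \<beta>)) \<in> borel_measurable B"
      by (intro borel_measurable_sum borel_measurable_times_ennreal borel_measurable_const mR)
    have "(\<integral>\<^sup>+\<omega>. (\<Sum>l = 1..m. ennreal (1 / m) * ennreal (\<bar>R k l \<omega>\<bar> powr \<beta>)) \<partial>B)
      = (\<Sum>l = 1..m. \<integral>\<^sup>+\<omega>. ennreal (1 / m) * ennreal (\<bar>R k l \<omega>\<bar> powr \<beta>) \<partial>B)"
      by (intro nn_integral_sum borel_measurable_times_ennreal borel_measurable_const mR)
    also have "\<dots> = (\<Sum>l = 1..m. ennreal (1 / m) * (\<integral>\<^sup>+\<omega>. \<bar>R k l \<omega>\<bar> powr \<beta> \<partial>B))"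
      by (intro sum.cong refl nn_integral_cmult mR)
    finally show ?thesis
      using mS by (simp add: nn_integral_cmult nn_integral_add emeasure_space_1)
  qed
  also have "\<dots> \<le> ennreal (2 powr \<beta>) * (?q + ?w * (\<Sum>l = 1..m. ennreal (1 / m) * ?b))"
    by (intro mult_left_mono add_left_mono sum_mono Suc.IH) auto
  also have "(\<Sum>l = 1..m. ennreal (1 / m) * ?b) = ?b"
  proof -
    have "of_nat m * ennreal (1 / m) = 1"
      using m_pos by (simp add: ennreal_of_nat_eq_real_of_nat flip: ennreal_mult')
    then show ?thesis
      by (simp flip: mult.assoc)
  qed
  finally show ?case by simp
qed

section \<open>Empirical characteristic functions and their sampling error\<close>

definition pool_char :: "nat \<Rightarrow> real \<Rightarrow> 'c \<Rightarrow> complex" where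
  "pool_char k t \<omega> = (\<Sum>i = 1..m. iexp (t * R k i \<omega>)) / of_nat m"

lemma norm_pool_char_le_1: "norm (pool_char k t \<omega>) \<le> 1"
proof -
  have "norm (\<Sum>i = 1..m. iexp (t * R k i \<omega>)) \<le> (\<Sum>i = 1..m. 1)"
    by (intro sum_norm_le) simp
  then show ?thesis
    using m_pos by (simp add: pool_char_def norm_divide)
qed

lemma measurable_pool_char:
  assumes "g \<in> measurable M (gen (past k))" "f \<in> borel_measurable M"
  shows "(\<lambda>x. pool_char k (f x) (g x)) \<in> borel_measurable M"
proof -
  have "(\<lambda>x. iexp (f x * R k i (g x))) \<in> borel_measurable M" if "i \<in> {1..m}" for i
    using measurable_compose[OF assms(1) measurable_pool[OF that]] assms(2) by measurable
  then have "(\<lambda>x. \<Sum>i = 1..m. iexp (f x * R k i (g x))) \<in> borel_measurable M"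
    by (intro borel_measurable_sum)
  then show ?thesis
    unfolding pool_char_def by measurable
qed

lemma sets_law: "sets \<mu> = sets branching_space"
  and prob_space_law: "prob_space \<mu>"
proof -
  have "vec 1 1 \<in> measurable B branching_space" "distr B branching_space (vec 1 1) = \<mu>"
    using vec_law[of 1 1] m_pos by (auto simp: has_law_def)
  then show "sets \<mu> = sets branching_space" "prob_space \<mu>"
    using prob_space_distr by auto
qed

lemma expectation_pool_char_dist_0:
  "expectation (\<lambda>\<omega>. norm (pool_char 0 t \<omega> - process_char \<mu> 0 t)) \<le> 3 / sqrt m"
  unfolding pool_char_def
proof (rule expectation_dist_average_le[OF _ m_pos])
  have m: "R 0 i \<in> borel_measurable (gen {Initial i})" if "i \<in> {1..m}" for i
    unfolding pool.simps(1)[abs_def] by (rule measurable_initial[OF that]) simp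
  show "indep_vars (\<lambda>_. borel) (\<lambda>i \<omega>. iexp (t * R 0 i \<omega>)) {1..m}"
  proof (rule indep_vars_gen[of "\<lambda>i. {Initial i}"])
    show "(\<lambda>\<omega>. iexp (t * R 0 i \<omega>)) \<in> borel_measurable (gen {Initial i})" if "i \<in> {1..m}" for i
      using m[OF that] by measurable
  qed (auto simp: disjoint_family_on_def)
  have fst_meas: "fst \<in> borel_measurable \<mu>"
    unfolding measurable_cong_sets[OF sets_law refl] by (rule measurable_branching_space_fst)
  show "expectation (\<lambda>\<omega>. iexp (t * R 0 i \<omega>)) = process_char \<mu> 0 t" if "i \<in> {1..m}" for i
  proof -
    have "expectation (\<lambda>\<omega>. iexp (t * R 0 i \<omega>)) = (\<integral>q. iexp (t * q) \<partial>distr \<mu> borel fst)"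
      unfolding pool.simps by (rule has_law_integral[OF initial_law[OF that]]) measurable
    also have "\<dots> = process_char \<mu> 0 t"
      unfolding process_char.simps by (rule integral_distr[OF fst_meas]) measurable
    finally show ?thesis .
  qed
qed simp

lemma measurable_branch_char_pool:
  assumes "g \<in> measurable M (gen (past k))" "V \<in> measurable M branching_space"
  shows "(\<lambda>x. branch_char (\<lambda>s. pool_char k s (g x)) t (V x)) \<in> borel_measurable M"
  by (rule measurable_branch_char[OF assms(2)]) (rule measurable_pool_char[OF assms(1)])

text \<open>Here \<open>\<omega>\<close> is an arbitrary parameter, possibly outside
  \<open>space B\<close>, where a constant map would not be measurable into
  \<open>gen (past k)\<close>; hence a separate argument.\<close>

lemma measurable_branch_char_pool_law:
  "(\<lambda>v. branch_char (\<lambda>s. pool_char k s \<omega>) t v) \<in> borel_measurable branching_space"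
proof (rule measurable_branch_char[where V = "\<lambda>v. v"])
  fix f :: "real \<times> nat \<times> (nat \<Rightarrow> real) \<Rightarrow> real" assume [measurable]: "f \<in> borel_measurable branching_space"
  have "(\<lambda>v. iexp (f v * x)) \<in> borel_measurable branching_space" for x
    by measurable
  then show "(\<lambda>v. pool_char k (f v) \<omega>) \<in> borel_measurable branching_space"
    unfolding pool_char_def by (intro borel_measurable_divide borel_measurable_sum borel_measurable_const)
qed simp

text \<open>With the old pool frozen, the new entries are i.i.d. and the integral over
  \<open>\<mu>\<close> is the mean of each exponential. The bound for averages is the same for every
  old pool, so it survives integration over it.\<close>

lemma expectation_pool_char_dist_conditional:
  "expectation (\<lambda>\<omega>. norm (pool_char (Suc k) t \<omega>
     - (\<integral>v. branch_char (\<lambda>s. pool_char k s \<omega>) t v \<partial>\<mu>))) \<le> 3 / sqrt m"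
proof -
  let ?S = "\<lambda>i \<omega> \<omega>'. branch_sum (vec (Suc k) i \<omega>') (\<lambda>r. R k (J (Suc k) i r \<omega>') \<omega>)"
  define \<psi> where "\<psi> \<omega> = (\<integral>v. branch_char (\<lambda>s. pool_char k s \<omega>) t v \<partial>\<mu>)" for \<omega>
  define A where "A = (\<Union>i\<in>{1..m}. fresh (Suc k) i)"
  define f where "f p = norm ((\<Sum>i = 1..m. iexp (t * ?S i (fst p) (snd p))) / of_nat m - \<psi> (fst p))" for p
  interpret \<mu>: prob_space \<mu> by (rule prob_space_law)
  have norm_\<psi>: "norm (\<psi> \<omega>) \<le> 1" for \<omega>
    unfolding \<psi>_def
  proof (rule order_trans[OF integral_norm_bound \<mu>.integral_le_const])
    have "(\<lambda>v. branch_char (\<lambda>s. pool_char k s \<omega>) t v) \<in> borel_measurable \<mu>"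
      unfolding measurable_cong_sets[OF sets_law refl] by (rule measurable_branch_char_pool_law)
    then show "integrable \<mu> (\<lambda>v. norm (branch_char (\<lambda>s. pool_char k s \<omega>) t v))"
      by (intro integrable_norm \<mu>.integrable_const_bound[where B = 1])
        (auto intro!: norm_branch_char_le_1 norm_pool_char_le_1)
    show "AE v in \<mu>. norm (branch_char (\<lambda>s. pool_char k s \<omega>) t v) \<le> 1"
      by (auto intro!: norm_branch_char_le_1 norm_pool_char_le_1)
  qed
  have \<psi>_meas: "\<psi> \<in> borel_measurable (gen (past k))"
    unfolding \<psi>_def[abs_def]
  proof (rule \<mu>.borel_measurable_lebesgue_integral)
    have "snd \<in> measurable (gen (past k) \<Otimes>\<^sub>M \<mu>) branching_space"
      using measurable_snd measurable_cong_sets[OF refl sets_law] by blast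
    then show "case_prod (\<lambda>\<omega>. branch_char (\<lambda>s. pool_char k s \<omega>) t) \<in> borel_measurable (gen (past k) \<Otimes>\<^sub>M \<mu>)"
      unfolding case_prod_beta' by (intro measurable_branch_char_pool measurable_fst)
  qed
  have S_meas: "(\<lambda>p. iexp (t * ?S i (fst p) (snd p))) \<in> borel_measurable (gen (past k) \<Otimes>\<^sub>M gen A)"
    if "i \<in> {1..m}" for i
  proof -
    have "fresh (Suc k) i \<subseteq> A"
      using that by (auto simp: A_def)
    from measurable_decoupled_pool[OF that this] show ?thesis
      by measurable
  qed
  have f_meas: "f \<in> borel_measurable (gen (past k) \<Otimes>\<^sub>M gen A)"
  proof -
    note [measurable] = borel_measurable_sum[OF S_meas] measurable_compose[OF measurable_fst \<psi>_meas]
    show ?thesis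
      unfolding f_def[abs_def] by measurable
  qed
  have f_bound: "norm (f p) \<le> 2" for p
  proof -
    have "norm (\<Sum>i = 1..m. iexp (t * ?S i (fst p) (snd p))) \<le> (\<Sum>i = 1..m. 1)"
      by (intro sum_norm_le) simp
    then have "norm ((\<Sum>i = 1..m. iexp (t * ?S i (fst p) (snd p))) / of_nat m) \<le> 1"
      using m_pos by (simp add: norm_divide)
    then show ?thesis
      unfolding f_def using norm_\<psi>[of "fst p"]
        norm_triangle_ineq4[of "(\<Sum>i = 1..m. iexp (t * ?S i (fst p) (snd p))) / of_nat m" "\<psi> (fst p)"]
      by simp
  qed
  have cond: "expectation (\<lambda>\<omega>'. f (\<omega>, \<omega>')) \<le> 3 / sqrt m" for \<omega>
    unfolding f_def fst_conv snd_conv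
  proof (rule expectation_dist_average_le[OF _ m_pos])
    have meas: "(\<lambda>\<omega>'. ?S i \<omega> \<omega>') \<in> borel_measurable (gen (fresh (Suc k) i))" if "i \<in> {1..m}" for i
    proof (rule measurable_branch_sum[where Y = "\<lambda>r \<omega>'. R k (J (Suc k) i r \<omega>') \<omega>"])
      show "vec (Suc k) i \<in> measurable (gen (fresh (Suc k) i)) branching_space"
        by (rule measurable_gen_mono[OF _ measurable_row(1)[OF that]]) (auto simp: row_sources_def fresh_def)
      show "(\<lambda>\<omega>'. R k (J (Suc k) i r \<omega>') \<omega>) \<in> borel_measurable (gen (fresh (Suc k) i))" if "r \<ge> 1" for r
        by (rule measurable_gen_mono[OF _ measurable_row(2)[OF \<open>i \<in> {1..m}\<close> that]])
          (auto simp: row_sources_def fresh_def)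
    qed
    show "indep_vars (\<lambda>_. borel) (\<lambda>i \<omega>'. iexp (t * ?S i \<omega> \<omega>')) {1..m}"
    proof (rule indep_vars_gen[of "fresh (Suc k)"])
      show "(\<lambda>\<omega>'. iexp (t * ?S i \<omega> \<omega>')) \<in> borel_measurable (gen (fresh (Suc k) i))" if "i \<in> {1..m}" for i
        using meas[OF that] by measurable
    qed (auto simp: disjoint_family_on_def fresh_def)
    show "expectation (\<lambda>\<omega>'. iexp (t * ?S i \<omega> \<omega>')) = \<psi> \<omega>" if "i \<in> {1..m}" for i
    proof -
      have "expectation (\<lambda>\<omega>'. iexp (t * ?S i \<omega> \<omega>'))
          = expectation (\<lambda>\<omega>'. branch_char (\<lambda>s. pool_char k s \<omega>) t (vec (Suc k) i \<omega>'))"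
      proof (rule integral_iexp_branch_sum[OF disjoint_row_sources measurable_row[OF that]])
        show "expectation (\<lambda>\<omega>'. iexp (s * R k (J (Suc k) i r \<omega>') \<omega>)) = pool_char k s \<omega>"
          if "r \<ge> 1" for r s
          using integral_uniform_index[OF index_law[OF _ \<open>i \<in> {1..m}\<close> that], of "Suc k" "\<lambda>l. iexp (s * R k l \<omega>)"]
          by (simp add: pool_char_def)
      qed
      also have "\<dots> = \<psi> \<omega>"
        unfolding \<psi>_def
        by (rule has_law_integral[OF vec_law[OF _ that] measurable_branch_char_pool_law]) simp
      finally show ?thesis .
    qed
  qed simp
  have "expectation (\<lambda>\<omega>. norm (pool_char (Suc k) t \<omega> - \<psi> \<omega>)) = expectation (\<lambda>\<omega>. f (\<omega>, \<omega>))"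
    unfolding f_def pool_char_def pool_Suc by simp
  also have "\<dots> = expectation (\<lambda>\<omega>. expectation (\<lambda>\<omega>'. f (\<omega>, \<omega>')))"
    unfolding A_def by (rule decouple_integral[OF past_fresh_disjoint f_meas[unfolded A_def] f_bound])
  also have "\<dots> \<le> 3 / sqrt m"
  \<comment> \<open>A Bochner integral of a non-integrable function is 0, so that case satisfies the
    bound as well.\<close>
  proof (cases "integrable B (\<lambda>\<omega>. expectation (\<lambda>\<omega>'. f (\<omega>, \<omega>')))")
    case True
    then show ?thesis
      by (rule integral_le_const) (use cond in auto)
  qed (simp add: not_integrable_integral_eq)
  finally show ?thesis
    unfolding \<psi>_def .
qed

end

section \<open>Propagation of the error from one level to the next\<close>

text \<open>The exponential factors have modulus 1, and products of numbers in the unit disc differ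
  by at most the sum of the differences of their factors.\<close>

lemma norm_branch_char_diff_le:
  assumes "\<And>s. norm (f s) \<le> 1" "\<And>s. norm (g s) \<le> 1"
  shows "norm (branch_char f t v - branch_char g t v)
    \<le> (\<Sum>r = 1..fst (snd v). norm (f (t * snd (snd v) r) - g (t * snd (snd v) r)))"
proof -
  have "norm (branch_char f t v - branch_char g t v)
    = norm ((\<Prod>r = 1..fst (snd v). f (t * snd (snd v) r)) - (\<Prod>r = 1..fst (snd v). g (t * snd (snd v) r)))"
    unfolding branch_char_def right_diff_distrib[symmetric] norm_mult norm_exp_i_times by simp
  also have "\<dots> \<le> (\<Sum>r = 1..fst (snd v). norm (f (t * snd (snd v) r) - g (t * snd (snd v) r)))"
    by (rule norm_prod_diff) (auto intro: assms)
  finally show ?thesis .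
qed

context bootstrap
begin

definition pool_char_error :: "nat \<Rightarrow> real \<Rightarrow> real" where
  "pool_char_error k t = expectation (\<lambda>\<omega>. norm (pool_char k t \<omega> - process_char \<mu> k t))"

text \<open>The expectation is over the pool with the vector \<open>v\<close> held fixed. The
  remaining integral is then over \<open>\<mu>\<close>, one measure for all pool sizes, where
  dominated convergence makes sense.\<close>

definition branch_char_error :: "nat \<Rightarrow> real \<Rightarrow> real \<times> nat \<times> (nat \<Rightarrow> real) \<Rightarrow> real" where
  "branch_char_error k t v = expectation (\<lambda>\<omega>.
     norm (branch_char (\<lambda>s. pool_char k s \<omega>) t v - branch_char (process_char \<mu> k) t v))"

lemma pool_char_measurable_B [measurable]: "pool_char k t \<in> borel_measurable B"
  using measurable_pool_char[OF measurable_ident_gen, of "\<lambda>_. t"] by simp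

lemma pool_char_error_nonneg: "0 \<le> pool_char_error k t"
  unfolding pool_char_error_def by (rule integral_nonneg_AE) simp

lemma process_char_diff_bound:
  assumes "\<And>s. norm (process_char \<mu> k s) \<le> 1"
  shows "norm (pool_char k t \<omega> - process_char \<mu> k t) \<le> 2"
    and "norm (branch_char (\<lambda>s. pool_char k s \<omega>) t v - branch_char (process_char \<mu> k) t v) \<le> 2"
proof -
  show "norm (pool_char k t \<omega> - process_char \<mu> k t) \<le> 2"
    using norm_triangle_ineq4[of "pool_char k t \<omega>" "process_char \<mu> k t"]
      norm_pool_char_le_1[of k t \<omega>] assms[of t] by linarith
  show "norm (branch_char (\<lambda>s. pool_char k s \<omega>) t v - branch_char (process_char \<mu> k) t v) \<le> 2"
    using norm_triangle_ineq4[of "branch_char (\<lambda>s. pool_char k s \<omega>) t v" "branch_char (process_char \<mu> k) t v"]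
      norm_branch_char_le_1[of "\<lambda>s. pool_char k s \<omega>" t v, OF norm_pool_char_le_1]
      norm_branch_char_le_1[of "process_char \<mu> k" t v, OF assms] by linarith
qed

lemma branch_char_diff_measurable:
  assumes \<phi>: "process_char \<mu> k \<in> borel_measurable borel"
  shows "(\<lambda>p. norm (branch_char (\<lambda>s. pool_char k s (fst p)) t (snd p)
    - branch_char (process_char \<mu> k) t (snd p))) \<in> borel_measurable (B \<Otimes>\<^sub>M \<mu>)"
proof -
  have [measurable]: "snd \<in> measurable (B \<Otimes>\<^sub>M \<mu>) branching_space"
    using measurable_snd measurable_cong_sets[OF refl sets_law] by blast
  have "(\<lambda>p. branch_char (\<lambda>s. pool_char k s (fst p)) t (snd p)) \<in> borel_measurable (B \<Otimes>\<^sub>M \<mu>)"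
    by (intro measurable_branch_char_pool measurable_compose[OF measurable_fst measurable_ident_gen]) measurable
  moreover have "(\<lambda>p. branch_char (process_char \<mu> k) t (snd p)) \<in> borel_measurable (B \<Otimes>\<^sub>M \<mu>)"
    by (rule measurable_branch_char) (auto intro: measurable_compose[OF _ \<phi>])
  ultimately show ?thesis
    by measurable
qed

text \<open>The two upper bounds have different roles: the finite sum carries convergence from level
  \<open>k\<close> to each fixed \<open>v\<close>, and the constant 2 is the dominating
  function.\<close>

lemma branch_char_error_bounds:
  assumes \<phi>: "process_char \<mu> k \<in> borel_measurable borel" "\<And>s. norm (process_char \<mu> k s) \<le> 1"
  shows "branch_char_error k t \<in> borel_measurable \<mu>"
    and "0 \<le> branch_char_error k t v" "branch_char_error k t v \<le> 2"
    and "branch_char_error k t v \<le> (\<Sum>r = 1..fst (snd v). pool_char_error k (t * snd (snd v) r))"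
proof -
  have swap: "(\<lambda>p. (snd p, fst p)) \<in> measurable (\<mu> \<Otimes>\<^sub>M B) (B \<Otimes>\<^sub>M \<mu>)"
    by measurable
  show "branch_char_error k t \<in> borel_measurable \<mu>"
    unfolding branch_char_error_def[abs_def]
    using measurable_compose[OF swap branch_char_diff_measurable[OF \<phi>(1)], of t]
    by (intro borel_measurable_lebesgue_integral) (simp add: case_prod_beta')
  show "0 \<le> branch_char_error k t v"
    unfolding branch_char_error_def by (rule integral_nonneg_AE) simp
  have int: "integrable B (\<lambda>\<omega>. norm (pool_char k s \<omega> - process_char \<mu> k s))" for s
    using process_char_diff_bound(1)[OF \<phi>(2)] by (intro integrable_const_bound[where B = 2]) auto
  \<comment> \<open>Since non-integrable functions get the value 0, the upper bounds need an
    argument only when the value is nonzero; measurability in \<open>\<omega>\<close> for each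
    individual \<open>v\<close> is thereby avoided.\<close>
  have nonint: "branch_char_error k t v = 0"
    if "\<not> integrable B (\<lambda>\<omega>. norm (branch_char (\<lambda>s. pool_char k s \<omega>) t v - branch_char (process_char \<mu> k) t v))"
    using that by (simp add: branch_char_error_def not_integrable_integral_eq)
  show "branch_char_error k t v \<le> 2"
  proof (cases "branch_char_error k t v = 0")
    case False
    then show ?thesis
      using nonint process_char_diff_bound(2)[OF \<phi>(2)] unfolding branch_char_error_def
      by (intro integral_le_const) auto
  qed simp
  show "branch_char_error k t v \<le> (\<Sum>r = 1..fst (snd v). pool_char_error k (t * snd (snd v) r))"
  proof (cases "branch_char_error k t v = 0")
    case True
    then show ?thesis
      by (simp add: sum_nonneg pool_char_error_nonneg)
  next
    case False
    have "branch_char_error k t v \<le> expectation (\<lambda>\<omega>. \<Sum>r = 1..fst (snd v).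
        norm (pool_char k (t * snd (snd v) r) \<omega> - process_char \<mu> k (t * snd (snd v) r)))"
      unfolding branch_char_error_def
    proof (rule integral_mono)
      show "integrable B (\<lambda>\<omega>. \<Sum>r = 1..fst (snd v).
        norm (pool_char k (t * snd (snd v) r) \<omega> - process_char \<mu> k (t * snd (snd v) r)))"
        by (intro Bochner_Integration.integrable_sum int)
      show "integrable B (\<lambda>\<omega>. norm (branch_char (\<lambda>s. pool_char k s \<omega>) t v - branch_char (process_char \<mu> k) t v))"
        using False nonint by blast
    qed (rule norm_branch_char_diff_le[OF norm_pool_char_le_1 \<phi>(2)])
    also have "\<dots> = (\<Sum>r = 1..fst (snd v). pool_char_error k (t * snd (snd v) r))"
      unfolding pool_char_error_def by (intro Bochner_Integration.integral_sum int)
    finally show ?thesis .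
  qed
qed

text \<open>Triangle inequality through the conditional mean \<open>\<psi>\<close>: the distance
  from the new empirical function to \<open>\<psi>\<close> is sampling noise of size
  \<open>3 / sqrt m\<close>, and the distance from \<open>\<psi>\<close> to the target is the error
  inherited from level \<open>k\<close>.\<close>

lemma pool_char_error_Suc:
  assumes \<phi>: "process_char \<mu> k \<in> borel_measurable borel" "\<And>s. norm (process_char \<mu> k s) \<le> 1"
    and \<phi>': "norm (process_char \<mu> (Suc k) t) \<le> 1"
  shows "pool_char_error (Suc k) t \<le> 3 / sqrt m + (\<integral>v. branch_char_error k t v \<partial>\<mu>)"
proof -
  interpret \<mu>: prob_space \<mu> by (rule prob_space_law)
  interpret B\<mu>: pair_prob_space B \<mu> ..
  let ?b = "\<lambda>\<omega> v. branch_char (\<lambda>s. pool_char k s \<omega>) t v" and ?c = "\<lambda>v. branch_char (process_char \<mu> k) t v"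
  let ?d = "\<lambda>\<omega> v. norm (?b \<omega> v - ?c v)"
  have b_int: "integrable \<mu> (?b \<omega>)" for \<omega>
    by (intro \<mu>.integrable_const_bound[where B = 1])
      (auto intro!: norm_branch_char_le_1 norm_pool_char_le_1 simp: measurable_cong_sets[OF sets_law refl]
        measurable_branch_char_pool_law)
  have c_int: "integrable \<mu> ?c"
  proof (intro \<mu>.integrable_const_bound[where B = 1])
    show "?c \<in> borel_measurable \<mu>"
      unfolding measurable_cong_sets[OF sets_law refl]
      by (rule measurable_branch_char[where V = "\<lambda>v. v"]) (auto intro: measurable_compose[OF _ \<phi>(1)])
  qed (auto intro!: norm_branch_char_le_1 \<phi>(2))
  define \<psi> where "\<psi> \<omega> = (\<integral>v. ?b \<omega> v \<partial>\<mu>)" for \<omega>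
  have d_int: "integrable (B \<Otimes>\<^sub>M \<mu>) (\<lambda>p. ?d (fst p) (snd p))"
    using process_char_diff_bound(2)[OF \<phi>(2)] branch_char_diff_measurable[OF \<phi>(1)]
    by (intro B\<mu>.P.integrable_const_bound[where B = 2]) auto
  have d_int': "integrable B (\<lambda>\<omega>. \<integral>v. ?d \<omega> v \<partial>\<mu>)"
    using B\<mu>.integrable_fst'[OF d_int] by simp
  have \<psi>_le: "norm (\<psi> \<omega> - process_char \<mu> (Suc k) t) \<le> (\<integral>v. ?d \<omega> v \<partial>\<mu>)" for \<omega>
  proof -
    have "\<psi> \<omega> - process_char \<mu> (Suc k) t = (\<integral>v. ?b \<omega> v - ?c v \<partial>\<mu>)"
      unfolding \<psi>_def process_char.simps by (rule Bochner_Integration.integral_diff[OF b_int c_int, symmetric])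
    then show ?thesis
      using integral_norm_bound by metis
  qed
  have \<psi>_meas: "\<psi> \<in> borel_measurable B"
    unfolding \<psi>_def[abs_def]
  proof (rule \<mu>.borel_measurable_lebesgue_integral)
    have "snd \<in> measurable (B \<Otimes>\<^sub>M \<mu>) branching_space"
      using measurable_snd measurable_cong_sets[OF refl sets_law] by blast
    then show "case_prod (\<lambda>\<omega>. ?b \<omega>) \<in> borel_measurable (B \<Otimes>\<^sub>M \<mu>)"
      unfolding case_prod_beta'
      by (intro measurable_branch_char_pool measurable_compose[OF measurable_fst measurable_ident_gen])
  qed
  have norm_\<psi>: "norm (\<psi> \<omega>) \<le> 1" for \<omega>
    unfolding \<psi>_def
    by (rule order_trans[OF integral_norm_bound \<mu>.integral_le_const])
      (auto intro!: integrable_norm b_int norm_branch_char_le_1 norm_pool_char_le_1)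
  have first_int: "integrable B (\<lambda>\<omega>. norm (pool_char (Suc k) t \<omega> - \<psi> \<omega>))"
  proof (rule integrable_const_bound[where B = 2])
    have "norm (pool_char (Suc k) t \<omega> - \<psi> \<omega>) \<le> 2" for \<omega>
      using norm_triangle_ineq4[of "pool_char (Suc k) t \<omega>" "\<psi> \<omega>"] norm_pool_char_le_1[of "Suc k" t \<omega>] norm_\<psi>[of \<omega>]
      by linarith
    then show "AE \<omega> in B. norm (norm (pool_char (Suc k) t \<omega> - \<psi> \<omega>)) \<le> 2" by simp
  qed (use \<psi>_meas in measurable)
  have "integrable B (\<lambda>\<omega>. norm (pool_char (Suc k) t \<omega> - process_char \<mu> (Suc k) t))"
  proof (rule integrable_const_bound[where B = 2])
    have "norm (pool_char (Suc k) t \<omega> - process_char \<mu> (Suc k) t) \<le> 2" for \<omega>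
      using norm_triangle_ineq4[of "pool_char (Suc k) t \<omega>" "process_char \<mu> (Suc k) t"]
        norm_pool_char_le_1[of "Suc k" t \<omega>] \<phi>' by linarith
    then show "AE \<omega> in B. norm (norm (pool_char (Suc k) t \<omega> - process_char \<mu> (Suc k) t)) \<le> 2" by simp
  qed simp
  then have "pool_char_error (Suc k) t \<le> expectation (\<lambda>\<omega>. norm (pool_char (Suc k) t \<omega> - \<psi> \<omega>) + (\<integral>v. ?d \<omega> v \<partial>\<mu>))"
    unfolding pool_char_error_def
  proof (rule integral_mono)
    fix \<omega>
    have "norm (pool_char (Suc k) t \<omega> - process_char \<mu> (Suc k) t)
        \<le> norm (pool_char (Suc k) t \<omega> - \<psi> \<omega>) + norm (\<psi> \<omega> - process_char \<mu> (Suc k) t)"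
      by (rule norm_diff_triangle_ineq[THEN order_trans[rotated]]) (simp add: algebra_simps)
    then show "norm (pool_char (Suc k) t \<omega> - process_char \<mu> (Suc k) t)
        \<le> norm (pool_char (Suc k) t \<omega> - \<psi> \<omega>) + (\<integral>v. ?d \<omega> v \<partial>\<mu>)"
      using \<psi>_le[of \<omega>] by linarith
  qed (intro Bochner_Integration.integrable_add first_int d_int')
  also have "\<dots> = expectation (\<lambda>\<omega>. norm (pool_char (Suc k) t \<omega> - \<psi> \<omega>)) + expectation (\<lambda>\<omega>. \<integral>v. ?d \<omega> v \<partial>\<mu>)"
    by (rule Bochner_Integration.integral_add[OF first_int d_int'])
  also have "\<dots> \<le> 3 / sqrt m + expectation (\<lambda>\<omega>. \<integral>v. ?d \<omega> v \<partial>\<mu>)"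
    unfolding \<psi>_def by (intro add_right_mono expectation_pool_char_dist_conditional)
  \<comment> \<open>Fubini: the integral over the pool moves inside, the one over the vector
    outside.\<close>
  also have "expectation (\<lambda>\<omega>. \<integral>v. ?d \<omega> v \<partial>\<mu>) = (\<integral>v. branch_char_error k t v \<partial>\<mu>)"
    unfolding branch_char_error_def
    by (rule B\<mu>.Fubini_integral[symmetric]) (use d_int in \<open>simp add: case_prod_beta'\<close>)
  finally show ?thesis .
qed

section \<open>Empirical measures and deviation probabilities\<close>

text \<open>The empirical measure of one realisation. It is an honest real distribution for every
  \<open>\<omega>\<close>, so the deterministic closeness criterion applies realisation by
  realisation.\<close>

definition pool_distribution :: "nat \<Rightarrow> 'c \<Rightarrow> real measure" where
  "pool_distribution k \<omega> = distr (uniform_count_measure {1..m}) borel (\<lambda>i. R k i \<omega>)"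

lemma real_distribution_pool: "real_distribution (pool_distribution k \<omega>)"
proof -
  have "prob_space (uniform_count_measure {1..m})"
    using m_pos by (intro prob_space_uniform_count_measure) auto
  then show ?thesis
    unfolding pool_distribution_def
    by (rule prob_space.real_distribution_distr) (simp add: measurable_cong_sets[OF sets_uniform_count_measure_count_space refl])
qed

lemma pool_index_measurable: "(\<lambda>i. R k i \<omega>) \<in> borel_measurable (uniform_count_measure {1..m})"
  by (simp add: measurable_cong_sets[OF sets_uniform_count_measure_count_space refl])

lemma integral_pool_distribution:
  assumes "h \<in> borel_measurable borel"
  shows "(\<integral>x. h x \<partial>pool_distribution k \<omega>) = (1 / real m) * (\<Sum>i = 1..m. h (R k i \<omega>))"
  unfolding pool_distribution_def
  by (subst integral_distr[OF pool_index_measurable assms]) (simp add: integral_uniform_count_measure)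

lemma char_pool_distribution: "char (pool_distribution k \<omega>) t = pool_char k t \<omega>"
  unfolding char_def pool_distribution_def pool_char_def
  by (subst integral_distr[OF pool_index_measurable])
    (auto simp: uniform_count_measure_def lebesgue_integral_point_measure_finite
      sum_divide_distrib scaleR_conv_of_real)

lemma nn_integral_pool_distribution:
  "(\<integral>\<^sup>+x. \<bar>x\<bar> powr \<beta> \<partial>pool_distribution k \<omega>) = ennreal ((\<Sum>i = 1..m. \<bar>R k i \<omega>\<bar> powr \<beta>) / m)"
proof -
  have "(\<integral>\<^sup>+x. \<bar>x\<bar> powr \<beta> \<partial>pool_distribution k \<omega>)
      = (\<Sum>i = 1..m. ennreal (1 / m) * ennreal (\<bar>R k i \<omega>\<bar> powr \<beta>))"
    unfolding pool_distribution_def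
    by (subst nn_integral_distr[OF pool_index_measurable])
      (auto simp: uniform_count_measure_def nn_integral_point_measure_finite)
  also have "\<dots> = ennreal ((\<Sum>i = 1..m. \<bar>R k i \<omega>\<bar> powr \<beta>) / m)"
    by (simp add: sum_divide_distrib flip: ennreal_mult' sum_ennreal)
  finally show ?thesis .
qed

text \<open>By \<open>close\<close>, a deviation beyond \<epsilon> forces the empirical moment to
  reach \<open>A\<close> or one of finitely many empirical characteristic values to be off by at
  least \<delta>. Markov's inequality handles each event; the expected empirical moment is bounded
  for all \<open>m\<close> at once.\<close>

lemma deviation_probability_le:
  assumes T: "finite T" "\<delta> > 0" "A > 0" "\<beta> > 1" and fin: "moment_bound \<mu> \<beta> k < \<infinity>"
    and \<phi>: "\<And>s. norm (process_char \<mu> k s) \<le> 1"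
    and h: "h \<in> borel_measurable borel"
    and close: "\<And>G. real_distribution G \<Longrightarrow> (\<integral>\<^sup>+x. \<bar>x\<bar> powr \<beta> \<partial>G) \<le> ennreal A \<Longrightarrow>
      (\<And>t. t \<in> T \<Longrightarrow> norm (char G t - process_char \<mu> k t) \<le> \<delta>) \<Longrightarrow> \<bar>(\<integral>x. h x \<partial>G) - c\<bar> \<le> \<epsilon>"
  shows "measure B {\<omega> \<in> space B. \<bar>(1 / real m) * (\<Sum>i = 1..m. h (R k i \<omega>)) - c\<bar> > \<epsilon>}
    \<le> enn2real (moment_bound \<mu> \<beta> k) / A + (\<Sum>t\<in>T. pool_char_error k t / \<delta>)"
proof -
  define u where "u \<omega> = (\<Sum>i = 1..m. \<bar>R k i \<omega>\<bar> powr \<beta>) / m" for \<omega>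
  define b where "b = enn2real (moment_bound \<mu> \<beta> k)"
  have b: "moment_bound \<mu> \<beta> k = ennreal b"
    using fin by (simp add: b_def less_top)
  have b_nonneg: "0 \<le> b"
    by (simp add: b_def)
  have R_meas: "R k i \<in> borel_measurable B" if "i \<in> {1..m}" for i
    by (rule measurable_gen_imp[OF measurable_pool[OF that]])
  have R_int: "integrable B (\<lambda>\<omega>. \<bar>R k i \<omega>\<bar> powr \<beta>)" if "i \<in> {1..m}" for i
    using le_less_trans[OF pool_moment[OF T(4) that, of k] fin] R_meas[OF that]
    by (intro integrableI_bounded) auto
  have R_le: "expectation (\<lambda>\<omega>. \<bar>R k i \<omega>\<bar> powr \<beta>) \<le> b" if "i \<in> {1..m}" for i
    using pool_moment[OF T(4) that, of k] R_int[OF that]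
    by (simp add: b b_nonneg nn_integral_eq_integral)
  have u_int: "integrable B u"
    unfolding u_def[abs_def] by (intro integrable_divide Bochner_Integration.integrable_sum R_int)
  have "expectation u = (\<Sum>i = 1..m. expectation (\<lambda>\<omega>. \<bar>R k i \<omega>\<bar> powr \<beta>)) / m"
    unfolding u_def[abs_def] integral_divide_zero
    by (subst Bochner_Integration.integral_sum) (auto intro: R_int)
  also have "\<dots> \<le> (\<Sum>i = 1..m. b) / m"
    by (intro divide_right_mono sum_mono R_le) auto
  finally have u_le: "expectation u \<le> b"
    using m_pos by simp
  have Markov1: "prob {\<omega> \<in> space B. A \<le> u \<omega>} \<le> b / A"
  proof -
    have "prob {\<omega> \<in> space B. A \<le> u \<omega>} \<le> expectation u / A"
      using T(3) by (intro integral_Markov_inequality_measure[OF u_int, of "{}"]) (auto simp: u_def sum_nonneg)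
    also have "\<dots> \<le> b / A"
      using u_le T(3) by (intro divide_right_mono) auto
    finally show ?thesis .
  qed
  have Markov2: "prob {\<omega> \<in> space B. \<delta> \<le> norm (pool_char k t \<omega> - process_char \<mu> k t)} \<le> pool_char_error k t / \<delta>" for t
  proof -
    have "integrable B (\<lambda>\<omega>. norm (pool_char k t \<omega> - process_char \<mu> k t))"
      using process_char_diff_bound(1)[OF \<phi>] by (intro integrable_const_bound[where B = 2]) auto
    then show ?thesis
      unfolding pool_char_error_def
      using T(2) by (intro integral_Markov_inequality_measure[of _ _ "{}"]) auto
  qed
  have u_meas: "u \<in> borel_measurable B"
    using u_int by (rule borel_measurable_integrable)
  let ?D = "\<lambda>t. {\<omega> \<in> space B. \<delta> \<le> norm (pool_char k t \<omega> - process_char \<mu> k t)}"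
  let ?U = "{\<omega> \<in> space B. A \<le> u \<omega>}"
  have U: "?U \<in> events"
    using u_meas by measurable
  have D: "?D t \<in> events" for t
    by measurable
  have UD: "(\<Union>t\<in>T. ?D t) \<in> events"
    by (intro sets.finite_UN T(1) D)
  \<comment> \<open>The contrapositive of \<open>close\<close>, applied to the empirical measure at
    a single \<open>\<omega>\<close>.\<close>
  have "{\<omega> \<in> space B. \<bar>(1 / real m) * (\<Sum>i = 1..m. h (R k i \<omega>)) - c\<bar> > \<epsilon>} \<subseteq> ?U \<union> (\<Union>t\<in>T. ?D t)"
  proof (rule subsetI, rule ccontr)
    fix \<omega>
    assume dev: "\<omega> \<in> {\<omega> \<in> space B. \<bar>(1 / real m) * (\<Sum>i = 1..m. h (R k i \<omega>)) - c\<bar> > \<epsilon>}"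
      and good: "\<omega> \<notin> ?U \<union> (\<Union>t\<in>T. ?D t)"
    have "\<bar>(\<integral>x. h x \<partial>pool_distribution k \<omega>) - c\<bar> \<le> \<epsilon>"
    proof (rule close[OF real_distribution_pool])
      show "(\<integral>\<^sup>+x. \<bar>x\<bar> powr \<beta> \<partial>pool_distribution k \<omega>) \<le> ennreal A"
        unfolding nn_integral_pool_distribution u_def[symmetric] using dev good
        by (intro ennreal_leI) auto
      show "norm (char (pool_distribution k \<omega>) t - process_char \<mu> k t) \<le> \<delta>" if "t \<in> T" for t
        unfolding char_pool_distribution using dev good that by (auto simp: not_le intro: less_imp_le)
    qed
    then show False
      using dev by (simp add: integral_pool_distribution[OF h])
  qed
  then have "prob {\<omega> \<in> space B. \<bar>(1 / real m) * (\<Sum>i = 1..m. h (R k i \<omega>)) - c\<bar> > \<epsilon>} \<le> prob (?U \<union> (\<Union>t\<in>T. ?D t))"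
    by (intro finite_measure_mono sets.Un U UD)
  also have "\<dots> \<le> prob ?U + prob (\<Union>t\<in>T. ?D t)"
    by (intro measure_Un_le U UD)
  also have "\<dots> \<le> prob ?U + (\<Sum>t\<in>T. prob (?D t))"
    by (intro add_left_mono measure_UNION_le T(1) D)
  also have "\<dots> \<le> b / A + (\<Sum>t\<in>T. pool_char_error k t / \<delta>)"
    by (intro add_mono sum_mono Markov1 Markov2)
  finally show ?thesis
    by (simp add: b_def)
qed

end

section \<open>Consistency\<close>

lemma tendsto_3_over_sqrt: "(\<lambda>m. 3 / sqrt (Suc m)) \<longlonglongrightarrow> 0"
  by (intro tendsto_divide_0[OF tendsto_const] filterlim_at_top_imp_at_infinity
      filterlim_compose[OF sqrt_at_top] filterlim_compose[OF filterlim_real_sequentially] filterlim_Suc)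

text \<open>The claim is for all \<open>t\<close> at once because a step at \<open>t\<close> uses
  level \<open>k\<close> at all the points \<open>t\<close> times a weight. Pool sizes are written
  \<open>Suc m\<close> so that the locale is available for every term of the sequence.\<close>

lemma pool_char_error_tendsto_0:
  assumes boot: "\<And>m. m \<ge> 1 \<Longrightarrow> bootstrap (B m) \<mu> m (Q m) (N m) (C m) (J m)"
    and \<phi>: "\<And>k. process_char \<mu> k \<in> borel_measurable borel" "\<And>k t. norm (process_char \<mu> k t) \<le> 1"
  shows "(\<lambda>m. bootstrap.pool_char_error (B (Suc m)) \<mu> (Suc m) (Q (Suc m)) (N (Suc m)) (C (Suc m)) (J (Suc m)) k t)
    \<longlonglongrightarrow> 0"
proof (induction k arbitrary: t)
  case 0
  interpret bootstrap "B (Suc m)" \<mu> "Suc m" "Q (Suc m)" "N (Suc m)" "C (Suc m)" "J (Suc m)" for m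
    by (rule boot) simp
  show ?case
  proof (rule tendsto_sandwich[OF _ _ tendsto_const])
    show "\<forall>\<^sub>F m in sequentially. bootstrap.pool_char_error (B (Suc m)) \<mu> (Suc m) (Q (Suc m)) (N (Suc m))
        (C (Suc m)) (J (Suc m)) 0 t \<le> 3 / sqrt (Suc m)"
      unfolding pool_char_error_def by (intro always_eventually allI expectation_pool_char_dist_0)
    show "(\<lambda>m. 3 / sqrt (Suc m)) \<longlonglongrightarrow> 0"
      by (rule tendsto_3_over_sqrt)
  qed (simp add: pool_char_error_nonneg)
next
  case (Suc k)
  interpret bootstrap "B (Suc m)" \<mu> "Suc m" "Q (Suc m)" "N (Suc m)" "C (Suc m)" "J (Suc m)" for m
    by (rule boot) simp
  interpret \<mu>: prob_space \<mu> by (rule prob_space_law)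
  let ?e = "\<lambda>m. bootstrap.pool_char_error (B (Suc m)) \<mu> (Suc m) (Q (Suc m)) (N (Suc m)) (C (Suc m)) (J (Suc m))"
  let ?b = "\<lambda>m. bootstrap.branch_char_error (B (Suc m)) \<mu> (Suc m) (Q (Suc m)) (N (Suc m)) (C (Suc m)) (J (Suc m)) k t"
  \<comment> \<open>For fixed \<open>v\<close> only finitely many arguments occur, so the induction
    hypothesis gives pointwise convergence, and 2 dominates on the probability space
    \<open>\<mu>\<close>.\<close>
  have "(\<lambda>m. \<integral>v. ?b m v \<partial>\<mu>) \<longlonglongrightarrow> (\<integral>v. 0 \<partial>\<mu>)"
  proof (rule integral_dominated_convergence[where w = "\<lambda>_. 2"])
    have "(\<lambda>m. ?b m v) \<longlonglongrightarrow> 0" for v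
    proof (rule tendsto_sandwich[OF _ _ tendsto_const])
      show "\<forall>\<^sub>F m in sequentially. ?b m v \<le> (\<Sum>r = 1..fst (snd v). ?e m k (t * snd (snd v) r))"
        by (intro always_eventually allI branch_char_error_bounds(4) \<phi>)
      show "(\<lambda>m. \<Sum>r = 1..fst (snd v). ?e m k (t * snd (snd v) r)) \<longlonglongrightarrow> 0"
        by (intro tendsto_null_sum Suc.IH)
      show "\<forall>\<^sub>F m in sequentially. 0 \<le> ?b m v"
        by (intro always_eventually allI branch_char_error_bounds(2) \<phi>)
    qed
    then show "AE v in \<mu>. (\<lambda>m. ?b m v) \<longlonglongrightarrow> 0"
      by simp
    show "AE v in \<mu>. norm (?b m v) \<le> 2" for m
      using branch_char_error_bounds(2,3)[OF \<phi>] by (simp add: abs_of_nonneg)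
    show "?b m \<in> borel_measurable \<mu>" for m
      by (rule branch_char_error_bounds(1)[OF \<phi>])
  qed simp_all
  then have "(\<lambda>m. 3 / sqrt (Suc m) + (\<integral>v. ?b m v \<partial>\<mu>)) \<longlonglongrightarrow> 0 + 0"
    by (intro tendsto_add tendsto_3_over_sqrt) simp
  then have lim: "(\<lambda>m. 3 / sqrt (Suc m) + (\<integral>v. ?b m v \<partial>\<mu>)) \<longlonglongrightarrow> 0"
    by simp
  show ?case
  proof (rule tendsto_sandwich[OF _ _ tendsto_const lim])
    show "\<forall>\<^sub>F m in sequentially. ?e m (Suc k) t \<le> 3 / sqrt (Suc m) + (\<integral>v. ?b m v \<partial>\<mu>)"
      by (intro always_eventually allI pool_char_error_Suc \<phi>)
  qed (simp add: pool_char_error_nonneg)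
qed

theorem theorem4p4:
  fixes M :: "'a measure" and Q :: "'a \<Rightarrow> real" and N :: "'a \<Rightarrow> nat" and C :: "nat \<Rightarrow> 'a \<Rightarrow> real"
    and T :: "'b measure" and Qt :: "nat list \<Rightarrow> 'b \<Rightarrow> real" and Nt :: "nat list \<Rightarrow> 'b \<Rightarrow> nat"
    and Ct :: "nat list \<Rightarrow> 'b \<Rightarrow> real"
    and B :: "nat \<Rightarrow> 'c measure" and Qb :: "nat \<Rightarrow> nat \<Rightarrow> nat \<Rightarrow> 'c \<Rightarrow> real"
    and Nb :: "nat \<Rightarrow> nat \<Rightarrow> nat \<Rightarrow> 'c \<Rightarrow> nat" and Cb :: "nat \<Rightarrow> nat \<Rightarrow> nat \<Rightarrow> nat \<Rightarrow> 'c \<Rightarrow> real"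
    and J :: "nat \<Rightarrow> nat \<Rightarrow> nat \<Rightarrow> nat \<Rightarrow> 'c \<Rightarrow> nat"
    and \<mu> :: "(real \<times> nat \<times> (nat \<Rightarrow> real)) measure"
    and \<beta> K :: real and h :: "real \<Rightarrow> real" and k :: nat
  assumes "prob_space M"
    and "has_law M branching_space (branching_vector Q N C) \<mu>"
    and "\<beta> > 1"
    and "integrable M (\<lambda>\<omega>. \<bar>Q \<omega>\<bar> powr \<beta>)"
    and "integrable M (\<lambda>\<omega>. (\<Sum>i = 1..N \<omega>. \<bar>C i \<omega>\<bar>) powr \<beta>)"
    and "max (rho M N C 1) (rho M N C \<beta>) < 1 \<or>
         \<beta> = 2 \<and> rho M N C 1 = 1 \<and> rho M N C \<beta> < 1 \<and> (\<integral>\<omega>. Q \<omega> \<partial>M) = 0"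
    and "continuous_on UNIV h"
    and "K > 0" and "\<And>x. \<bar>h x\<bar> \<le> K * (1 + \<bar>x\<bar>)"
    and "branching_tree T \<mu> Qt Nt Ct"
    and "\<And>m. m \<ge> 1 \<Longrightarrow> bootstrap_inputs (B m) \<mu> m (Qb m) (Nb m) (Cb m) (J m)"
  shows "integrable T (\<lambda>\<omega>. h (tree_process Qt Nt Ct k \<omega>)) \<and>
         converges_in_probability B
           (\<lambda>m \<omega>. (1 / real m) * (\<Sum>i = 1..m. h (pool (Qb m) (Nb m) (Cb m) (J m) k i \<omega>)))
           (\<integral>\<omega>. h (tree_process Qt Nt Ct k \<omega>) \<partial>T)"
proof -
  note law = assms(2) and \<beta> = assms(3) and h_growth = assms(9) and tree = assms(10)
  have h_meas: "h \<in> borel_measurable borel"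
    using assms(7) by (rule borel_measurable_continuous_onI)
  have boot: "bootstrap (B m) \<mu> m (Qb m) (Nb m) (Cb m) (J m)" if "m \<ge> 1" for m
    using assms(11)[OF that] that by (rule bootstrap.intro)
  interpret T: prob_space T
    using tree by (simp add: branching_tree_def)
  have R_meas [measurable]: "tree_process Qt Nt Ct j \<in> borel_measurable T" for j
    using tree by (intro tree_process_measurable) (simp add: branching_tree_def has_law_def)
  let ?F = "\<lambda>j. distr T borel (tree_process Qt Nt Ct j)"
  have F: "real_distribution (?F j)" for j
    by (rule T.real_distribution_distr) simp
  \<comment> \<open>Ties the recursion to an actual law, which supplies the measurability and the
    bound by 1 that the pool lemmas assume of \<open>process_char\<close>.\<close>
  have char_F: "process_char \<mu> j = char (?F j)" for j
    using tree_process_law(1)[OF tree \<beta>, of _ j] by (auto simp: char_def integral_distr fun_eq_iff)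
  have \<phi>: "process_char \<mu> j \<in> borel_measurable borel" "norm (process_char \<mu> j t) \<le> 1" for j t
    unfolding char_F using real_distribution.char_measurable[OF F] real_distribution.cmod_char_le_1[OF F] by auto
  have "(\<integral>\<^sup>+v. \<bar>fst v\<bar> powr \<beta> \<partial>\<mu>) = (\<integral>\<^sup>+\<omega>. \<bar>Q \<omega>\<bar> powr \<beta> \<partial>M)"
    by (subst has_law_nn_integral[OF law, symmetric]) (measurable, simp add: branching_vector_def)
  moreover have "(\<integral>\<^sup>+v. weight_sum v powr \<beta> \<partial>\<mu>) = (\<integral>\<^sup>+\<omega>. (\<Sum>i = 1..N \<omega>. \<bar>C i \<omega>\<bar>) powr \<beta> \<partial>M)"
    by (subst has_law_nn_integral[OF law, symmetric])
      (measurable, simp add: branching_vector_def weight_sum_def)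
  ultimately have fin: "moment_bound \<mu> \<beta> k < \<infinity>"
    using assms(4,5) by (intro moment_bound_finite) (simp_all add: integrable_iff_bounded)
  define b where "b = enn2real (moment_bound \<mu> \<beta> k)"
  have b: "moment_bound \<mu> \<beta> k = ennreal b" and b_nonneg: "0 \<le> b"
    using fin by (simp_all add: b_def less_top)
  have F_moment: "(\<integral>\<^sup>+x. \<bar>x\<bar> powr \<beta> \<partial>?F k) \<le> ennreal A" if "b \<le> A" for A
  proof -
    have "(\<integral>\<^sup>+x. \<bar>x\<bar> powr \<beta> \<partial>?F k) \<le> ennreal b"
      using tree_process_law(2)[OF tree \<beta>, of k] by (simp add: nn_integral_distr flip: b)
    then show ?thesis
      using ennreal_leI[OF that] by (rule order_trans)
  qed
  let ?c = "\<integral>\<omega>. h (tree_process Qt Nt Ct k \<omega>) \<partial>T"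
  have c_eq: "(\<integral>x. h x \<partial>?F k) = ?c"
    by (rule integral_distr) (simp_all add: h_meas)
  have "integrable (?F k) h"
    \<comment> \<open>\<open>zero_less_one\<close> fixes the clipping level at 1; any positive level
      gives integrability.\<close>
    by (rule real_distribution.integral_clip_error(1)[OF F F_moment[OF order_refl] b_nonneg \<beta> assms(8)
          zero_less_one h_meas h_growth])
  then have "integrable T (\<lambda>\<omega>. h (tree_process Qt Nt Ct k \<omega>))"
    by (subst (asm) integrable_distr_eq) (simp_all add: h_meas)
  moreover have "converges_in_probability B
      (\<lambda>m \<omega>. (1 / real m) * (\<Sum>i = 1..m. h (pool (Qb m) (Nb m) (Cb m) (J m) k i \<omega>))) ?c"
    (is "converges_in_probability B ?X ?c")
    unfolding converges_in_probability_def
  proof (intro conjI allI impI)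
    have "prob_space (B m) \<and> ?X m \<in> borel_measurable (B m)" if "m \<ge> 1" for m
    proof
      interpret bootstrap "B m" \<mu> m "Qb m" "Nb m" "Cb m" "J m"
        using that by (rule boot)
      show "prob_space (B m)" by unfold_locales
      have "(\<lambda>\<omega>. h (R k i \<omega>)) \<in> borel_measurable (B m)" if "i \<in> {1..m}" for i
        using measurable_gen_imp[OF measurable_pool[OF that]] h_meas by (rule measurable_compose)
      then show "?X m \<in> borel_measurable (B m)"
        by (intro borel_measurable_times borel_measurable_const borel_measurable_sum)
    qed
    then show "\<forall>\<^sub>F m in sequentially. prob_space (B m) \<and> ?X m \<in> borel_measurable (B m)"
      using eventually_ge_at_top[of 1] by (rule eventually_mono[rotated])
  next
    fix \<epsilon> :: real assume "\<epsilon> > 0"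
    let ?p = "\<lambda>m. measure (B m) {\<omega> \<in> space (B m). \<bar>?X m \<omega> - ?c\<bar> > \<epsilon>}"
    let ?e = "\<lambda>m. bootstrap.pool_char_error (B (Suc m)) \<mu> (Suc m) (Qb (Suc m)) (Nb (Suc m)) (Cb (Suc m)) (J (Suc m)) k"
    have "(\<lambda>m. ?p (Suc m)) \<longlonglongrightarrow> 0"
    proof (rule tendstoI)
      fix \<eta> :: real assume "\<eta> > 0"
      \<comment> \<open>\<open>A\<close> is at least \<open>b\<close>, so the limit law obeys the
        same moment bound, and it is so large that
        \<open>b / A < \<eta> / (\<eta> + 2) < \<eta> / 2\<close>.\<close>
      define A where "A = (b + 1) * (1 + 2 / \<eta>)"
      have A: "A > 0" "b \<le> A" "b / A < \<eta> / 2"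
        using \<open>\<eta> > 0\<close> b_nonneg by (simp_all add: A_def field_simps add_pos_nonneg)
      \<comment> \<open>The finite set and the tolerance depend on \<open>A\<close> and \<epsilon>
        but not on the pool size, so the pool size may go to infinity afterwards.\<close>
      obtain S \<delta> where S: "finite S" "\<delta> > 0"
        and close: "\<And>G. real_distribution G \<Longrightarrow> (\<integral>\<^sup>+x. \<bar>x\<bar> powr \<beta> \<partial>G) \<le> ennreal A \<Longrightarrow>
          (\<And>t. t \<in> S \<Longrightarrow> norm (char G t - process_char \<mu> k t) \<le> \<delta>) \<Longrightarrow>
          \<bar>(\<integral>x. h x \<partial>G) - ?c\<bar> \<le> \<epsilon>"
        using integral_close_if_char_close[OF F F_moment[OF A(2)] less_imp_le[OF A(1)] \<beta> assms(8)
            assms(7) h_growth \<open>\<epsilon> > 0\<close>, unfolded c_eq, folded char_F]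
        by metis
      have "(\<lambda>m. \<Sum>t\<in>S. ?e m t / \<delta>) \<longlonglongrightarrow> 0"
        by (intro tendsto_null_sum tendsto_divide_zero pool_char_error_tendsto_0 boot \<phi>)
      then have "\<forall>\<^sub>F m in sequentially. (\<Sum>t\<in>S. ?e m t / \<delta>) < \<eta> / 2"
        using \<open>\<eta> > 0\<close> by (intro order_tendstoD(2)) auto
      then show "\<forall>\<^sub>F m in sequentially. dist (?p (Suc m)) 0 < \<eta>"
      proof (rule eventually_mono)
        fix m assume sum_less: "(\<Sum>t\<in>S. ?e m t / \<delta>) < \<eta> / 2"
        have "?p (Suc m) \<le> b / A + (\<Sum>t\<in>S. ?e m t / \<delta>)"
          unfolding b_def
          by (rule bootstrap.deviation_probability_le[OF boot S A(1) \<beta> fin \<phi>(2) h_meas close]) simp_all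
        then have "?p (Suc m) < \<eta>"
          using sum_less A(3) by linarith
        then show "dist (?p (Suc m)) 0 < \<eta>"
          by (simp only: dist_real_def diff_0_right abs_of_nonneg measure_nonneg)
      qed
    qed
    then show "?p \<longlonglongrightarrow> 0"
      by (rule LIMSEQ_imp_Suc)
  qed
  ultimately show ?thesis ..
qed

end
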